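(* For any $R>0$ there exists a $T=T(R,\alpha)>0$ such that, for all $\theta_1,\theta_2\ge0$ with $|\theta_1-\theta_2|\le1$, $$\big\|(\mathcal{T}_tid_{x_0})(\theta_1)-(\mathcal{T}_tid_{x_0})(\theta_2)\big\|\le\frac{2G_*}{\alpha\Gamma(\alpha)}\,|\theta_1-\theta_2|^\alpha,\quad\forall t\ge T,$$ uniformly for all $x_0\in\mathbb{R}^d$ with $\|x_0\|\le R$, where $G_*$ is the $R$-independent constant $G_*=\sup_{x\in B^*}\sqrt d\,\|g(x)\|$.
   Context: Let $d\in\mathbb{N}$, $\alpha\in(0,1)$, and let $\langle\cdot,\cdot\rangle$, $\|\cdot\|$ be the standard inner product and norm of $\mathbb{R}^d$. Let $g:\mathbb{R}^d\to\mathbb{R}^d$ be locally Lipschitz and satisfy $\langle x,g(x)\rangle\le a-b\|x\|^2$ for all $x\in\mathbb{R}^d$, for some constants $a,b>0$. Put $\delta^*:=\sqrt{a/b+1}$ and $B^*:=\{y\in\mathbb{R}^d:\|y\|\le\delta^*\}$. $\Gamma$ is the Gamma function. For $x_0\in\mathbb{R}^d$ let $x(\cdot,x_0)\in C([0,\infty),\mathbb{R}^d)$ denote the solution of the Caputo fractional differential equation ${}^C\!D^\alpha_{0+}x(t)=g(x(t))$, $t>0$, $x(0)=x_0$, i.e. of the integral equation $x(t)=x_0+\frac1{\Gamma(\alpha)}\int_0^t(t-s)^{\alpha-1}g(x(s))\,ds$, $t\ge0$. Let $id_{x_0}$ be the constant function $id_{x_0}(\theta)\equiv x_0$ on $[0,\infty)$.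 The Volterra semiflow $\{\mathcal{T}_t\}_{t\ge0}$ on $C([0,\infty),\mathbb{R}^d)$ acts on constant functions by $$(\mathcal{T}_tid_{x_0})(\theta)=x_0+\frac1{\Gamma(\alpha)}\int_0^t(t+\theta-s)^{\alpha-1}g(x(s,x_0))\,ds,\quad t,\theta\ge0.$$ *)

theory Defs
  imports "HOL-Analysis.Analysis"
begin

text \<open>
  A global solution \<open>x(\<cdot>, x0)\<close> of the Caputo equation of order \<open>\<alpha>\<close> with right-hand side \<open>g\<close> and
  initial value \<open>x0\<close>, in the sense of the equivalent Volterra integral equation.  Only the values
  of \<open>x\<close> on \<open>[0,\<infinity>)\<close> are constrained.  For continuous \<open>g\<close> the integrand is absolutely integrable
  on \<open>[0,t]\<close>; the value \<open>0 powr (\<alpha> - 1) = 0\<close> at the endpoint \<open>s = t\<close> is irrelevant.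
\<close>
definition caputo_solution ::
    "real \<Rightarrow> (real ^ 'd \<Rightarrow> real ^ 'd) \<Rightarrow> real ^ 'd \<Rightarrow> (real \<Rightarrow> real ^ 'd) \<Rightarrow> bool" where
  "caputo_solution \<alpha> g x0 x \<longleftrightarrow>
     continuous_on {0..} x \<and>
     (\<forall>t\<ge>0. x t = x0 + (1 / Gamma \<alpha>) *\<^sub>R
        integral {0..t} (\<lambda>s. (t - s) powr (\<alpha> - 1) *\<^sub>R g (x s)))"

text \<open>
  The value \<open>(\<T>\<^sub>t id\<^sub>x\<^sub>0)(\<theta>)\<close> of the Volterra semiflow on the constant function \<open>x0\<close>.  The
  argument \<open>x\<close> stands for the solution \<open>x(\<cdot>, x0)\<close>.
\<close>
definition volterra_semiflow_const ::
    "real \<Rightarrow> (real ^ 'd \<Rightarrow> real ^ 'd) \<Rightarrow> (real \<Rightarrow> real ^ 'd) \<Rightarrow> real \<Rightarrow> real ^ 'd \<Rightarrow> real \<Rightarrow> real ^ 'd" where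
  "volterra_semiflow_const \<alpha> g x t x0 \<theta> =
     x0 + (1 / Gamma \<alpha>) *\<^sub>R
       integral {0..t} (\<lambda>s. (t + \<theta> - s) powr (\<alpha> - 1) *\<^sub>R g (x s))"

definition delta_star :: "real \<Rightarrow> real \<Rightarrow> real" where
  "delta_star a b = sqrt (a / b + 1)"

definition B_star :: "real \<Rightarrow> real \<Rightarrow> (real ^ 'd) set" where
  "B_star a b = {y. norm y \<le> delta_star a b}"

definition G_star :: "(real ^ 'd \<Rightarrow> real ^ 'd) \<Rightarrow> real \<Rightarrow> real \<Rightarrow> real" where
  "G_star g a b = (SUP x\<in>B_star a b. sqrt (real CARD('d)) * norm (g x))"

text \<open>
  The library notion \<^const>\<open>local_lipschitz\<close> is for time-dependent maps; an autonomous \<open>g\<close> is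
  regarded as constant in time.
\<close>
abbreviation locally_lipschitz :: "(real ^ 'd \<Rightarrow> real ^ 'd) \<Rightarrow> bool" where
  "locally_lipschitz g \<equiv> local_lipschitz (UNIV :: real set) UNIV (\<lambda>_. g)"

end

theory Submission
  imports Defs
begin

text \<open>
  The difference of the semiflow at \<open>\<theta>\<close> and \<open>\<theta> + h\<close> is \<open>1 / \<Gamma>(\<alpha>)\<close> times the integral over \<open>[0,t]\<close> of
  \<open>g (x s)\<close> against the positive weight \<open>(t + \<theta> - s)\<^sup>\<alpha>\<^sup>-\<^sup>1 - (t + \<theta> + h - s)\<^sup>\<alpha>\<^sup>-\<^sup>1\<close>.  If \<open>x s\<close> lies in the ball \<open>B_star\<close> for all
  \<open>s \<ge> L\<close>, the part over \<open>[L,t]\<close> is at most \<open>G_star\<close> times the integral of the weight, and subadditivity of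
  \<open>u\<^sup>\<alpha>\<close> bounds that integral by \<open>h\<^sup>\<alpha> / \<alpha>\<close>.  On \<open>[0,L]\<close> the weight is at most \<open>h / (t - L)\<close> once \<open>t \<ge> L + 1\<close>, so this part
  becomes as small as desired for large \<open>t\<close>.  It is absorbed by a second copy of \<open>G_star h\<^sup>\<alpha> / \<alpha>\<close>, because
  \<open>h \<le> h\<^sup>\<alpha>\<close> and because \<open>G_star\<close> is positive: on the boundary of \<open>B_star\<close> the dissipativity condition
  forces \<open>x \<bullet> g x < 0\<close>.

  The substance is therefore absorption: all solutions with \<open>norm x0 \<le> R\<close> enter \<open>B_star\<close> by a common time
  \<open>L\<close> and stay there.  Formally \<open>u = (norm x)\<^sup>2\<close> satisfies \<open>D\<^sup>\<alpha> u \<le> 2 x \<bullet> D\<^sup>\<alpha> x \<le> 2a - 2b u\<close>, but a priori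
  a solution is only Hoelder continuous of order \<open>\<alpha>\<close>, which does not ensure that \<open>D\<^sup>\<alpha> u\<close> exists pointwise.
  The argument uses increments of the memory integral \<open>\<integral>\<^sub>0\<^sup>T \<sigma>\<^sup>-\<^sup>\<alpha> q (t - \<sigma>) d\<sigma>\<close> instead; up to the factor
  \<open>\<Gamma>(1 - \<alpha>)\<close>, its derivative in \<open>t\<close> is the Caputo derivative of \<open>q\<close>.  Four facts carry the proof.

  \<^item> For a solution, the increment of the memory integral over \<open>[r,t]\<close> is \<open>\<Gamma>(1 - \<alpha>) \<integral>\<^sub>r\<^sup>t g (x s) ds\<close>
    (\<open>caputo_solution_memory_increment\<close>, by Fubini and the Beta integral).
  \<^item> For \<open>u = (norm x)\<^sup>2\<close> it is at most \<open>2 \<Gamma>(1 - \<alpha>) \<integral>\<^sub>r\<^sup>t x \<bullet> g x ds\<close> (\<open>caputo_solution_energy_inequality\<close>).  A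
    step of length \<open>h\<close> costs an error of order \<open>h\<^sup>1\<^sup>+\<^sup>\<alpha>\<close>, which disappears when the partition is refined.
  \<^item> A continuous \<open>e\<close> with \<open>e 0 < 0\<close> whose memory increments are at most \<open>-\<mu> \<integral> e\<close> stays nonpositive
    (\<open>memory_comparison\<close>).  The maximum principle is applied to the moving average of \<open>e\<close>, which is
    differentiable.
  \<^item> The straight line from \<open>a/b + 1 + R\<^sup>2\<close> at time \<open>0\<close> down to \<open>a/b + 1\<close> at time \<open>T\<close> is a barrier for \<open>u\<close> as
    soon as \<open>T\<close> is large enough (\<open>caputo_solution_absorption\<close>).  Each such \<open>T\<close> has its own line, and the
    line for \<open>T\<close> places \<open>x T\<close> in \<open>B_star\<close>.
\<close>

section \<open>Power kernels\<close>

lemma has_integral_powr_kernel: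
  fixes \<alpha> :: real
  assumes "0 < \<alpha>" "p \<le> t" "t \<le> c"
  shows "((\<lambda>s. (c - s) powr (\<alpha> - 1)) has_integral ((c - p) powr \<alpha> - (c - t) powr \<alpha>) / \<alpha>) {p..t}"
proof -
  have "((\<lambda>s. (c - s) powr (\<alpha> - 1)) has_integral
      (- ((c - t) powr \<alpha> / \<alpha>) - - ((c - p) powr \<alpha> / \<alpha>))) {p..t}"
  proof (rule fundamental_theorem_of_calculus_interior)
    show "continuous_on {p..t} (\<lambda>s. - ((c - s) powr \<alpha> / \<alpha>))"
      using assms by (intro continuous_intros continuous_on_powr') auto
    show "((\<lambda>s. - ((c - s) powr \<alpha> / \<alpha>)) has_vector_derivative (c - s) powr (\<alpha> - 1)) (at s)"
      if "s \<in> {p<..<t}" for s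
      using that assms
      by (auto intro!: derivative_eq_intros simp: has_real_derivative_iff_has_vector_derivative[symmetric])
  qed (use assms in auto)
  then show ?thesis by (simp add: diff_divide_distrib)
qed

lemma nonneg_kernel_integrable:
  fixes k :: "real \<Rightarrow> real" and w :: "real \<Rightarrow> 'a::euclidean_space"
  assumes "k integrable_on {p..t}" "\<And>s. s \<in> {p..t} \<Longrightarrow> 0 \<le> k s" "continuous_on {p..t} w"
  shows "(\<lambda>s. k s *\<^sub>R w s) integrable_on {p..t}"
proof -
  have k: "k absolutely_integrable_on {p..t}"
    using assms by (intro nonnegative_absolutely_integrable_1) auto
  have "bilinear (\<lambda>(v::'a) (r::real). r *\<^sub>R v)"
    by (auto simp: bilinear_def linear_iff algebra_simps)
  from absolutely_integrable_bounded_measurable_product[OF this _ _ _ k, of w]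
  have "(\<lambda>s. k s *\<^sub>R w s) absolutely_integrable_on {p..t}"
    using assms(3)
    by (simp add: continuous_imp_measurable_on_sets_lebesgue compact_imp_bounded compact_continuous_image)
  then show ?thesis
    using absolutely_integrable_on_def by blast
qed

lemma nonneg_kernel_norm_bound:
  fixes k :: "real \<Rightarrow> real" and w :: "real \<Rightarrow> 'a::euclidean_space"
  assumes k: "(k has_integral I) {p..t}" "\<And>s. s \<in> {p..t} \<Longrightarrow> 0 \<le> k s"
    and w: "continuous_on {p..t} w" "\<And>s. s \<in> {p..t} \<Longrightarrow> norm (w s) \<le> M"
  shows "norm (integral {p..t} (\<lambda>s. k s *\<^sub>R w s)) \<le> M * I"
proof -
  have "norm (integral {p..t} (\<lambda>s. k s *\<^sub>R w s)) \<le> integral {p..t} (\<lambda>s. M * k s)"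
  proof (rule integral_norm_bound_integral)
    show "(\<lambda>s. k s *\<^sub>R w s) integrable_on {p..t}"
      using k w by (intro nonneg_kernel_integrable) auto
    show "(\<lambda>s. M * k s) integrable_on {p..t}"
      using has_integral_mult_right[OF k(1), of M] by (rule has_integral_integrable)
    show "norm (k s *\<^sub>R w s) \<le> M * k s" if "s \<in> {p..t}" for s
      using mult_right_mono[OF w(2) k(2), of s s] that k(2)[of s] by (simp add: mult.commute)
  qed
  also have "\<dots> = M * I" using k by (simp add: integral_unique)
  finally show ?thesis .
qed

lemma powr_subadditive:
  fixes x y \<alpha> :: real
  assumes "0 < \<alpha>" "\<alpha> < 1" "0 \<le> x" "0 \<le> y"
  shows "(x + y) powr \<alpha> \<le> x powr \<alpha> + y powr \<alpha>"
proof (cases "x = 0 \<or> y = 0")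
  case False
  have *: "z powr \<alpha> = z * z powr (\<alpha> - 1)" if "0 < z" for z :: real
    using that powr_add[of z 1 "\<alpha> - 1"] by simp
  have "(x + y) powr (\<alpha> - 1) \<le> x powr (\<alpha> - 1)" "(x + y) powr (\<alpha> - 1) \<le> y powr (\<alpha> - 1)"
    using assms False by (auto intro!: powr_mono2')
  then have "x * (x + y) powr (\<alpha> - 1) + y * (x + y) powr (\<alpha> - 1)
      \<le> x * x powr (\<alpha> - 1) + y * y powr (\<alpha> - 1)"
    using assms by (intro add_mono mult_left_mono) auto
  then show ?thesis
    using assms False *[of x] *[of y] *[of "x + y"] by (simp add: algebra_simps)
qed (use assms in auto)

text \<open>
  The weight is nonnegative, so its explicit integral suffices.  After dropping the favourable
  difference \<open>(c - p)\<^sup>\<alpha> - (c + h - p)\<^sup>\<alpha>\<close>, subadditivity bounds what remains independently of the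
  interval.  The estimate serves both for the Hoelder continuity of solutions and for the
  semiflow.
\<close>
lemma powr_kernel_difference_bound:
  fixes w :: "real \<Rightarrow> 'a::euclidean_space"
  assumes \<alpha>: "0 < \<alpha>" "\<alpha> < 1" and t: "p \<le> t" and c: "t \<le> c" and h: "0 \<le> h"
    and w: "continuous_on {p..t} w" "\<And>s. s \<in> {p..t} \<Longrightarrow> norm (w s) \<le> M"
  shows "norm (integral {p..t} (\<lambda>s. ((c - s) powr (\<alpha> - 1) - (c + h - s) powr (\<alpha> - 1)) *\<^sub>R w s))
     \<le> M * (h powr \<alpha> / \<alpha>)"
proof -
  have M: "0 \<le> M" using order_trans[OF norm_ge_zero w(2)[of t]] t by simp
  let ?I = "((c - p) powr \<alpha> - (c - t) powr \<alpha>) / \<alpha> - ((c + h - p) powr \<alpha> - (c + h - t) powr \<alpha>) / \<alpha>"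
  \<comment> \<open>At \<open>s = c\<close> the convention \<open>0 powr (\<alpha> - 1) = 0\<close> would make the weight negative; one point is negligible.\<close>
  define k where "k = (\<lambda>s. if s = c then 0 else (c - s) powr (\<alpha> - 1) - (c + h - s) powr (\<alpha> - 1))"
  have "((\<lambda>s. (c - s) powr (\<alpha> - 1) - (c + h - s) powr (\<alpha> - 1)) has_integral ?I) {p..t}"
    using assms by (intro has_integral_diff has_integral_powr_kernel) auto
  then have k: "(k has_integral ?I) {p..t}"
    by (rule has_integral_spike[rotated 2, of _ _ _ "{c}"]) (auto simp: k_def)
  have "norm (integral {p..t} (\<lambda>s. k s *\<^sub>R w s)) \<le> M * ?I"
  proof (rule nonneg_kernel_norm_bound[OF k _ w])
    show "0 \<le> k s" if "s \<in> {p..t}" for s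
      using that assms by (auto simp: k_def intro!: powr_mono2')
  qed
  also have "integral {p..t} (\<lambda>s. k s *\<^sub>R w s) =
      integral {p..t} (\<lambda>s. ((c - s) powr (\<alpha> - 1) - (c + h - s) powr (\<alpha> - 1)) *\<^sub>R w s)"
    by (rule integral_spike[of "{c}"]) (auto simp: k_def)
  finally have 1: "norm (integral {p..t} (\<lambda>s. ((c - s) powr (\<alpha> - 1) - (c + h - s) powr (\<alpha> - 1)) *\<^sub>R w s))
      \<le> M * ?I" .
  have "(c - p) powr \<alpha> \<le> (c + h - p) powr \<alpha>"
    using assms by (intro powr_mono2) auto
  moreover have "(c + h - t) powr \<alpha> \<le> (c - t) powr \<alpha> + h powr \<alpha>"
    using powr_subadditive[OF \<alpha>, of "c - t" h] c h by (simp add: algebra_simps)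
  ultimately have "?I \<le> h powr \<alpha> / \<alpha>"
    unfolding diff_divide_distrib[symmetric] using \<alpha> by (intro divide_right_mono) linarith+
  with 1 M show ?thesis by (meson mult_left_mono order_trans)
qed

text \<open>
  With \<open>\<rho> = y / (y + h)\<close> the difference equals \<open>y\<^sup>\<alpha>\<^sup>-\<^sup>1 (1 - \<rho>\<^sup>1\<^sup>-\<^sup>\<alpha>)\<close>, where the first factor is at
  most \<open>1\<close> and the second at most \<open>1 - \<rho> = h / (y + h)\<close>.  This controls the influence of the remote
  past.
\<close>
lemma powr_difference_far:
  fixes \<alpha> \<tau> y h :: real
  assumes \<alpha>: "0 < \<alpha>" "\<alpha> < 1" and y: "1 \<le> \<tau>" "\<tau> \<le> y" and h: "0 \<le> h"
  shows "\<bar>y powr (\<alpha> - 1) - (y + h) powr (\<alpha> - 1)\<bar> \<le> h / \<tau>"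
proof -
  define \<rho> where "\<rho> = y / (y + h)"
  have \<rho>: "0 < \<rho>" "\<rho> \<le> 1" using y h by (auto simp: \<rho>_def)
  have "\<rho> powr (1 - \<alpha>) = y powr (1 - \<alpha>) / (y + h) powr (1 - \<alpha>)"
    unfolding \<rho>_def using y h by (simp add: powr_divide)
  also have "\<dots> = (y + h) powr (\<alpha> - 1) / y powr (\<alpha> - 1)"
    using powr_minus_divide[of y "1 - \<alpha>"] powr_minus_divide[of "y + h" "1 - \<alpha>"] y h by simp
  finally have eq: "y powr (\<alpha> - 1) - (y + h) powr (\<alpha> - 1) = y powr (\<alpha> - 1) * (1 - \<rho> powr (1 - \<alpha>))"
    using y by (simp add: algebra_simps)
  have y1: "y powr (\<alpha> - 1) \<le> 1"
    using powr_mono[of "\<alpha> - 1" 0 y] y \<alpha> by simp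
  have "\<rho> powr 1 \<le> \<rho> powr (1 - \<alpha>)" using \<rho> \<alpha> by (intro powr_mono') auto
  then have low: "1 - \<rho> powr (1 - \<alpha>) \<le> 1 - \<rho>" using \<rho> by simp
  have le1: "\<rho> powr (1 - \<alpha>) \<le> 1" using powr_mono'[of 0 "1 - \<alpha>" \<rho>] \<rho> \<alpha> by simp
  have "\<bar>y powr (\<alpha> - 1) - (y + h) powr (\<alpha> - 1)\<bar> = y powr (\<alpha> - 1) * (1 - \<rho> powr (1 - \<alpha>))"
    using le1 unfolding eq by (simp add: abs_mult)
  also have "\<dots> \<le> 1 * (1 - \<rho>)"
    using y1 low le1 by (intro mult_mono) auto
  also have "1 - \<rho> = h / (y + h)" using y h by (simp add: \<rho>_def field_simps)
  also have "1 * (h / (y + h)) \<le> h / \<tau>" using y h by (simp add: frac_le)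
  finally show ?thesis .
qed

section \<open>Inversion of the fractional integral\<close>

text \<open>
  Fubini's theorem is applied to the Bochner integral over \<^const>\<open>lborel\<close>, whereas the solution concept
  uses the Henstock-Kurzweil integral; nonnegativity makes the two agree for the singular kernels.
\<close>
lemma nonneg_kernel_has_bochner_integral:
  fixes k :: "real \<Rightarrow> real"
  assumes "(k has_integral I) {p..t}" "\<And>s. s \<in> {p..t} \<Longrightarrow> 0 \<le> k s"
    and [measurable]: "k \<in> borel_measurable borel"
  shows "has_bochner_integral lborel (\<lambda>s. indicator {p..t} s * k s) I"
proof (rule has_bochner_integral_nn_integral)
  show "0 \<le> I" using assms(1,2) by (rule has_integral_nonneg)
  show "(\<integral>\<^sup>+ s. ennreal (indicator {p..t} s * k s) \<partial>lborel) = ennreal I"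
    using nn_integral_has_integral_lebesgue[of "{p..t}" k I, OF _ assms(1)] assms(2)
    by (auto simp: indicator_def split: if_splits)
qed (use assms in \<open>auto simp: indicator_def\<close>)

lemma nonneg_kernel_set_integrable:
  fixes k :: "real \<Rightarrow> real" and w :: "real \<Rightarrow> 'a::euclidean_space"
  assumes "(k has_integral I) {p..t}" "\<And>s. s \<in> {p..t} \<Longrightarrow> 0 \<le> k s"
    and [measurable]: "k \<in> borel_measurable borel" and w: "continuous_on UNIV w"
  shows "set_integrable lborel {p..t} (\<lambda>s. k s *\<^sub>R w s)"
proof -
  have [measurable]: "w \<in> borel_measurable borel"
    using w by (rule borel_measurable_continuous_onI)
  have "bounded (w ` {p..t})"
    by (intro compact_imp_bounded compact_continuous_image continuous_on_subset[OF w]) auto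
  then obtain M where M: "\<forall>s\<in>{p..t}. norm (w s) \<le> M"
    unfolding bounded_iff by blast
  have "integrable lborel (\<lambda>s. M * (indicator {p..t} s * k s))"
    using nonneg_kernel_has_bochner_integral[OF assms(1-3)]
    by (intro integrable_mult_right) (auto simp: has_bochner_integral_iff)
  then show ?thesis
    unfolding set_integrable_def
  proof (rule Bochner_Integration.integrable_bound)
    have "norm (k s *\<^sub>R w s) \<le> norm (M * k s)" if "s \<in> {p..t}" for s
      using mult_left_mono[OF order_trans[OF bspec[OF M that] abs_ge_self] abs_ge_zero[of "k s"]]
      by (simp add: abs_mult mult.commute)
    then show "AE s in lborel. norm (indicator {p..t} s *\<^sub>R k s *\<^sub>R w s) \<le> norm (M * (indicator {p..t} s * k s))"
      by (intro AE_I2) (simp add: indicator_def)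
  qed simp
qed

text \<open>
  The affine substitution \<open>s = r + (t - r) u\<close> turns this into the Beta integral \<open>B(\<alpha>, 1 - \<alpha>)\<close>: the
  exponents \<open>-\<alpha>\<close> and \<open>\<alpha> - 1\<close> add up to \<open>-1\<close>, so the powers of \<open>t - r\<close> cancel against the Jacobian and
  the value does not depend on the interval.
\<close>
lemma Beta_kernel_has_integral:
  fixes \<alpha> :: real
  assumes \<alpha>: "0 < \<alpha>" "\<alpha> < 1" and rt: "r < t"
  shows "((\<lambda>s. (t - s) powr - \<alpha> * (s - r) powr (\<alpha> - 1)) has_integral Gamma \<alpha> * Gamma (1 - \<alpha>)) {r..t}"
proof -
  define m where "m = 1 / (t - r)"
  have m: "0 < m" using rt by (simp add: m_def)
  have mt: "m * t = 1 + m * r" using rt by (simp add: m_def field_simps)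
  have r: "r * m / m = r" and t: "(1 + r * m) / m = t"
    using rt by (auto simp: m_def field_simps)
  have "Beta \<alpha> (1 - \<alpha>) = Gamma \<alpha> * Gamma (1 - \<alpha>)" by (simp add: Beta_def)
  then have "((\<lambda>u. u powr (\<alpha> - 1) * (1 - u) powr - \<alpha>) has_integral Gamma \<alpha> * Gamma (1 - \<alpha>)) (cbox 0 1)"
    using has_integral_Beta_real[of \<alpha> "1 - \<alpha>"] \<alpha> by simp
  from has_integral_mult_right[OF has_integral_affinity'[OF this m, of "- r * m"], of m]
  have "((\<lambda>s. m * ((m * s - r * m) powr (\<alpha> - 1) * (1 - (m * s - r * m)) powr - \<alpha>))
      has_integral Gamma \<alpha> * Gamma (1 - \<alpha>)) {r..t}"
    using m r t by (simp add: inverse_eq_divide)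
  then show ?thesis
  proof (rule has_integral_eq[rotated])
    fix s assume s: "s \<in> {r..t}"
    have "m * s - r * m = m * (s - r)" "1 - (m * s - r * m) = m * (t - s)"
      using mt by (simp_all add: algebra_simps)
    then have "m * ((m * s - r * m) powr (\<alpha> - 1) * (1 - (m * s - r * m)) powr - \<alpha>)
        = (m powr 1 * m powr (\<alpha> - 1) * m powr - \<alpha>) * ((t - s) powr - \<alpha> * (s - r) powr (\<alpha> - 1))"
      using m s by (simp add: powr_mult)
    also have "m powr 1 * m powr (\<alpha> - 1) * m powr - \<alpha> = 1"
      using m by (simp only: powr_add[symmetric]) simp
    finally show "m * ((m * s - r * m) powr (\<alpha> - 1) * (1 - (m * s - r * m)) powr - \<alpha>)
        = (t - s) powr - \<alpha> * (s - r) powr (\<alpha> - 1)" by simp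
  qed
qed

text \<open>
  The kernels of order \<open>\<alpha>\<close> and \<open>1 - \<alpha>\<close> convolve to a constant, so exchanging the two integrations
  leaves the plain integral of \<open>f\<close>.
\<close>
lemma fractional_integral_inversion:
  fixes f :: "real \<Rightarrow> 'a::euclidean_space"
  assumes \<alpha>: "0 < \<alpha>" "\<alpha> < 1" and t: "0 \<le> t" and f: "continuous_on UNIV f"
  shows "integral {0..t} (\<lambda>s. (t - s) powr - \<alpha> *\<^sub>R integral {0..s} (\<lambda>r. (s - r) powr (\<alpha> - 1) *\<^sub>R f r))
     = (Gamma \<alpha> * Gamma (1 - \<alpha>)) *\<^sub>R integral {0..t} f"
proof -
  define B where "B = Gamma \<alpha> * Gamma (1 - \<alpha>)"
  \<comment> \<open>The triangle \<open>0 \<le> r \<le> s \<le> t\<close> is built into the kernel so that both orders of integration run over the whole line.\<close>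
  define k where "k r s = (if 0 \<le> r \<and> r \<le> s \<and> s \<le> t then (t - s) powr - \<alpha> * (s - r) powr (\<alpha> - 1) else 0)" for r s
  define H where "H r s = k r s *\<^sub>R f r" for r s
  have B0: "0 \<le> B" unfolding B_def using \<alpha> by (intro mult_nonneg_nonneg) (auto intro: less_imp_le Gamma_real_pos)
  have [measurable]: "f \<in> borel_measurable borel"
    using f by (rule borel_measurable_continuous_onI)
  have kmeas [measurable]: "(\<lambda>z. k (fst z) (snd z)) \<in> borel_measurable (lborel \<Otimes>\<^sub>M lborel)"
    unfolding k_def by measurable
  have Hmeas: "(\<lambda>(r, s). H r s) \<in> borel_measurable (lborel \<Otimes>\<^sub>M lborel)"
    unfolding H_def split_beta by measurable
  have k0: "0 \<le> k r s" for r s by (auto simp: k_def)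
  have kint: "has_bochner_integral lborel (k r) (indicator {0..<t} r * B)" for r
  proof (cases "0 \<le> r \<and> r < t")
    case True
    have "has_bochner_integral lborel (\<lambda>s. indicator {r..t} s * ((t - s) powr - \<alpha> * (s - r) powr (\<alpha> - 1))) B"
      unfolding B_def using True
      by (intro nonneg_kernel_has_bochner_integral Beta_kernel_has_integral \<alpha>) auto
    moreover have "(\<lambda>s. indicator {r..t} s * ((t - s) powr - \<alpha> * (s - r) powr (\<alpha> - 1))) = k r"
      using True by (auto simp: k_def indicator_def)
    ultimately show ?thesis using True by simp
  next
    case False
    then have "k r = (\<lambda>_. 0)" by (auto simp: k_def fun_eq_iff)
    then show ?thesis using False by auto
  qed
  have inner1: "has_bochner_integral lborel (H r) ((indicator {0..<t} r * B) *\<^sub>R f r)" for r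
    unfolding H_def by (rule has_bochner_integral_scaleR_left) (use kint in auto)
  have "set_integrable lborel {0..t} (\<lambda>r. B *\<^sub>R f r)"
    by (intro borel_integrable_atLeastAtMost' continuous_intros continuous_on_subset[OF f]) auto
  then have Bint: "set_integrable lborel {0..<t} (\<lambda>r. B *\<^sub>R f r)"
    by (rule set_integrable_subset) auto
  have Hint: "integrable (lborel \<Otimes>\<^sub>M lborel) (\<lambda>(r, s). H r s)"
  proof (rule lborel_pair.Fubini_integrable[OF Hmeas])
    have "(\<integral>s. norm (H r s) \<partial>lborel) = norm (indicator {0..<t} r *\<^sub>R B *\<^sub>R f r)" for r
    proof -
      have "has_bochner_integral lborel (\<lambda>s. k r s * norm (f r)) ((indicator {0..<t} r * B) * norm (f r))"
        using kint by (intro has_bochner_integral_mult_left) auto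
      then show ?thesis
        using k0 B0 by (simp add: H_def has_bochner_integral_iff indicator_def)
    qed
    then show "integrable lborel (\<lambda>r. \<integral>s. norm (case (r, s) of (r, s) \<Rightarrow> H r s) \<partial>lborel)"
      using integrable_norm[OF Bint[unfolded set_integrable_def]] by simp
    show "AE r in lborel. integrable lborel (\<lambda>s. case (r, s) of (r, s) \<Rightarrow> H r s)"
      using inner1 by (auto simp: has_bochner_integral_iff)
  qed
  have inner2: "(\<integral>r. H r s \<partial>lborel) = indicator {0..t} s *\<^sub>R ((t - s) powr - \<alpha> *\<^sub>R integral {0..s} (\<lambda>r. (s - r) powr (\<alpha> - 1) *\<^sub>R f r))" for s
  proof (cases "0 \<le> s \<and> s \<le> t")
    case True
    have "set_integrable lborel {0..s} (\<lambda>r. (s - r) powr (\<alpha> - 1) *\<^sub>R f r)"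
      using True by (intro nonneg_kernel_set_integrable[OF has_integral_powr_kernel[OF \<alpha>(1)] _ _ f]) auto
    then have "(LINT r:{0..s}|lborel. (s - r) powr (\<alpha> - 1) *\<^sub>R f r) = integral {0..s} (\<lambda>r. (s - r) powr (\<alpha> - 1) *\<^sub>R f r)"
      by (rule set_borel_integral_eq_integral)
    moreover have "H r s = (t - s) powr - \<alpha> *\<^sub>R (indicator {0..s} r *\<^sub>R (s - r) powr (\<alpha> - 1) *\<^sub>R f r)" for r
      using True by (auto simp: H_def k_def indicator_def)
    ultimately show ?thesis using True by (simp add: set_lebesgue_integral_def del: scaleR_scaleR)
  next
    case False
    then have "H r s = 0" for r by (auto simp: H_def k_def)
    then show ?thesis using False by auto
  qed
  have "integral {0..t} (\<lambda>s. (t - s) powr - \<alpha> *\<^sub>R integral {0..s} (\<lambda>r. (s - r) powr (\<alpha> - 1) *\<^sub>R f r))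
      = (\<integral>s. (\<integral>r. H r s \<partial>lborel) \<partial>lborel)"
  proof -
    have "integrable lborel (\<lambda>s. \<integral>r. H r s \<partial>lborel)"
      using lborel_pair.integrable_snd[OF Hint] by simp
    then show ?thesis
      unfolding inner2
      by (subst set_borel_integral_eq_integral(2)[symmetric]) (simp_all add: set_integrable_def set_lebesgue_integral_def)
  qed
  also have "\<dots> = (\<integral>r. (\<integral>s. H r s \<partial>lborel) \<partial>lborel)"
    by (rule lborel_pair.Fubini_integral[OF Hint])
  also have "\<dots> = (LINT r:{0..<t}|lborel. B *\<^sub>R f r)"
    by (simp only: has_bochner_integral_integral_eq[OF inner1] set_lebesgue_integral_def scaleR_scaleR)
  also have "\<dots> = integral {0..<t} (\<lambda>r. B *\<^sub>R f r)"
    using Bint by (rule set_borel_integral_eq_integral)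
  also have "\<dots> = integral {0..t} (\<lambda>r. B *\<^sub>R f r)"
    by (rule integral_subset_negligible) (auto intro: negligible_subset[of "{t}"])
  finally show ?thesis by (simp add: B_def)
qed

section \<open>The memory integral\<close>

text \<open>
  For \<open>q\<close> constant on \<open>(-\<infinity>,0]\<close> and \<open>0 \<le> t \<le> T\<close> this is, up to a constant summand, \<open>\<Gamma>(1 - \<alpha>)\<close> times the
  fractional integral of order \<open>1 - \<alpha>\<close> of \<open>q - q 0\<close>.  The integration runs over the age \<open>\<sigma> = t - s\<close> on
  an interval that does not depend on \<open>t\<close>: increments in \<open>t\<close> are then differences of integrals with one
  common weight, and the initial value need not be subtracted because constants cancel.
\<close>
definition memory_integral :: "real \<Rightarrow> real \<Rightarrow> (real \<Rightarrow> 'a::euclidean_space) \<Rightarrow> real \<Rightarrow> 'a" where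
  "memory_integral \<alpha> T q t = integral {0..T} (\<lambda>\<sigma>. \<sigma> powr - \<alpha> *\<^sub>R q (t - \<sigma>))"

lemma memory_integrable:
  fixes q :: "real \<Rightarrow> 'a::euclidean_space"
  assumes "\<alpha> < 1" "continuous_on UNIV q" "0 \<le> p" "p \<le> r"
  shows "(\<lambda>\<sigma>. \<sigma> powr - \<alpha> *\<^sub>R q (t - \<sigma>)) integrable_on {p..r}"
proof (rule nonneg_kernel_integrable)
  have "(\<lambda>\<sigma>. \<sigma> powr - \<alpha>) integrable_on {0..r}"
    using assms by (intro integrable_on_powr_from_0) auto
  then show "(\<lambda>\<sigma>. \<sigma> powr - \<alpha>) integrable_on {p..r}"
    by (rule integrable_on_subinterval) (use assms in auto)
  show "continuous_on {p..r} (\<lambda>\<sigma>. q (t - \<sigma>))"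
    by (intro continuous_on_compose2[OF assms(2)] continuous_intros) auto
qed auto

lemma memory_integral_linear:
  fixes q :: "real \<Rightarrow> 'a::euclidean_space" and L :: "'a \<Rightarrow> 'b::euclidean_space"
  assumes "\<alpha> < 1" "continuous_on UNIV q" "0 \<le> T" "bounded_linear L"
  shows "memory_integral \<alpha> T (\<lambda>s. L (q s)) t = L (memory_integral \<alpha> T q t)"
  using integral_linear[OF memory_integrable[OF assms(1,2) order_refl assms(3), of t] assms(4)]
  by (simp add: memory_integral_def o_def linear_cmul[OF bounded_linear.linear[OF assms(4)]])

lemma memory_integral_add:
  fixes q :: "real \<Rightarrow> 'a::euclidean_space"
  assumes "\<alpha> < 1" "continuous_on UNIV p" "continuous_on UNIV q" "0 \<le> T"
  shows "memory_integral \<alpha> T (\<lambda>s. p s + q s) t = memory_integral \<alpha> T p t + memory_integral \<alpha> T q t"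
  unfolding memory_integral_def scaleR_add_right
  using assms by (intro integral_add memory_integrable) auto

lemma memory_integral_diff:
  fixes q :: "real \<Rightarrow> 'a::euclidean_space"
  assumes "\<alpha> < 1" "continuous_on UNIV p" "continuous_on UNIV q" "0 \<le> T"
  shows "memory_integral \<alpha> T (\<lambda>s. p s - q s) t = memory_integral \<alpha> T p t - memory_integral \<alpha> T q t"
  unfolding memory_integral_def scaleR_diff_right
  using assms by (intro integral_diff memory_integrable) auto

lemma memory_integral_const:
  "memory_integral \<alpha> T (\<lambda>_. c) t = memory_integral \<alpha> T (\<lambda>_. c) s"
  by (simp add: memory_integral_def)

text \<open>
  A nonnegative history loses influence as it ages: the part older than \<open>h\<close> reappears at time \<open>t\<close>
  with a smaller weight than it had at time \<open>t - h\<close>, so only the most recent stretch of length \<open>h\<close> can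
  contribute to the growth.  Since \<open>q\<close> vanishes at \<open>t\<close> to order \<open>2 \<alpha>\<close>, that contribution is \<open>o(h)\<close>.
\<close>
lemma memory_integral_increment_le:
  fixes q :: "real \<Rightarrow> real"
  assumes \<alpha>: "0 < \<alpha>" "\<alpha> < 1" and h: "0 \<le> h" "h \<le> T"
    and q: "continuous_on UNIV q" "\<And>s. 0 \<le> q s"
    and flat: "\<And>\<sigma>. 0 \<le> \<sigma> \<Longrightarrow> \<sigma> \<le> h \<Longrightarrow> q (t - \<sigma>) \<le> C * \<sigma> powr (2 * \<alpha>)"
  shows "memory_integral \<alpha> T q t - memory_integral \<alpha> T q (t - h) \<le> C * (h powr (1 + \<alpha>) / (1 + \<alpha>))"
proof -
  let ?k = "\<lambda>t \<sigma>. \<sigma> powr - \<alpha> * q (t - \<sigma>)"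
  have int: "?k t integrable_on {p..r}" if "0 \<le> p" "p \<le> r" for t p r
    using memory_integrable[OF \<alpha>(2) q(1) that, of t] by simp
  have "memory_integral \<alpha> T q t = integral {0..h} (?k t) + integral {h..T} (?k t)"
    unfolding memory_integral_def real_scaleR_def
    using h by (intro Henstock_Kurzweil_Integration.integral_combine[symmetric] int) auto
  moreover have "integral {0..h} (?k t) \<le> C * (h powr (1 + \<alpha>) / (1 + \<alpha>))"
  proof (rule has_integral_le)
    show "(?k t has_integral integral {0..h} (?k t)) {0..h}"
      using h by (intro integrable_integral int) auto
    show "((\<lambda>\<sigma>. C * \<sigma> powr \<alpha>) has_integral C * (h powr (1 + \<alpha>) / (1 + \<alpha>))) {0..h}"
      using has_integral_powr_from_0[of \<alpha> h] \<alpha> h by (intro has_integral_mult_right) (auto simp: add.commute)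
    show "?k t \<sigma> \<le> C * \<sigma> powr \<alpha>" if "\<sigma> \<in> {0..h}" for \<sigma>
    proof -
      have "?k t \<sigma> \<le> \<sigma> powr - \<alpha> * (C * \<sigma> powr (2 * \<alpha>))"
        using that by (intro mult_left_mono flat) auto
      also have "\<dots> = C * \<sigma> powr \<alpha>"
        by (simp add: mult.left_commute powr_add[symmetric])
      finally show ?thesis .
    qed
  qed
  moreover have "integral {h..T} (?k t) \<le> memory_integral \<alpha> T q (t - h)"
  proof -
    have "integral {h..T} (?k t) = integral {h - h..T - h} (\<lambda>\<sigma>. ?k t (\<sigma> + h))"
      by (rule integral_shift_real_ivl[symmetric])
    also have "\<dots> = integral {0..T - h} (\<lambda>\<sigma>. ?k t (\<sigma> + h))" by simp
    \<comment> \<open>Monotonicity of the weight fails at \<open>\<sigma> = 0\<close>, where \<open>0 powr - \<alpha> = 0\<close>; that point is negligible.\<close>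
    also have "\<dots> = integral {0..T - h} (\<lambda>\<sigma>. if \<sigma> = 0 then 0 else ?k t (\<sigma> + h))"
      by (rule integral_spike[of "{0}"]) auto
    also have "\<dots> \<le> integral {0..T - h} (?k (t - h))"
    proof (rule integral_le)
      have "(\<lambda>\<sigma>. ?k t (\<sigma> + h)) integrable_on {0..T - h}"
        using has_integral_shift_real_ivl[OF integrable_integral[OF int[of h T t]], of h] h
        by (auto simp: integrable_on_def)
      then show "(\<lambda>\<sigma>. if \<sigma> = 0 then 0 else ?k t (\<sigma> + h)) integrable_on {0..T - h}"
        by (rule integrable_spike[of _ _ "{0}"]) auto
      show "(if \<sigma> = 0 then 0 else ?k t (\<sigma> + h)) \<le> ?k (t - h) \<sigma>" if "\<sigma> \<in> {0..T - h}" for \<sigma>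
        using that h \<alpha> q(2) by (auto intro!: mult_mono powr_mono2' simp: algebra_simps)
    qed (use h in \<open>auto intro!: int\<close>)
    also have "\<dots> \<le> integral {0..T} (?k (t - h))"
      using h q by (intro integral_subset_le int) auto
    finally show ?thesis by (simp add: memory_integral_def)
  qed
  ultimately show ?thesis by linarith
qed

section \<open>A comparison principle\<close>

text \<open>
  This is an Abel summation for integrals: a decreasing positive weight is a positive mixture of the
  indicators of the intervals \<open>[0,s]\<close>.  The second mean value theorem gives this on \<open>[d,T]\<close>, away from the
  singularity, up to an error of order \<open>d\<^sup>1\<^sup>-\<^sup>\<alpha>\<close>.
\<close>
lemma weighted_integral_nonneg:
  fixes \<phi> :: "real \<Rightarrow> real"
  assumes \<alpha>: "0 < \<alpha>" "\<alpha> < 1" and T: "0 < T" and \<phi>: "continuous_on {0..T} \<phi>"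
    and pos: "\<And>s. s \<in> {0..T} \<Longrightarrow> 0 \<le> integral {0..s} \<phi>"
  shows "0 \<le> integral {0..T} (\<lambda>s. s powr - \<alpha> * \<phi> s)"
proof -
  have "compact (\<phi> ` {0..T})" using \<phi> by (intro compact_continuous_image) auto
  then obtain C where C: "\<And>s. s \<in> {0..T} \<Longrightarrow> \<bar>\<phi> s\<bar> \<le> C"
    using compact_imp_bounded bounded_iff by (metis image_eqI real_norm_def)
  have int\<phi>: "\<phi> integrable_on {p..q}" if "0 \<le> p" "q \<le> T" for p q
    using that by (intro integrable_continuous_interval continuous_on_subset[OF \<phi>]) auto
  have wint: "(\<lambda>s. s powr - \<alpha> * \<phi> s) integrable_on {0..T}"
  proof -
    have "(\<lambda>s. s powr - \<alpha> *\<^sub>R \<phi> s) integrable_on {0..T}"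
      using \<alpha> T \<phi> integrable_on_powr_from_0[of "-\<alpha>" T]
      by (intro nonneg_kernel_integrable) auto
    then show ?thesis by simp
  qed
  have low: "- C * d powr (1 - \<alpha>) \<le> integral {d..T} (\<lambda>s. s powr - \<alpha> * \<phi> s)" if d: "0 < d" "d \<le> T" for d
  proof -
    \<comment> \<open>The negated weight is increasing, as the second mean value theorem requires.\<close>
    have "- (x powr - \<alpha>) \<le> - (y powr - \<alpha>)" if "d \<le> x" "x \<le> y" "y \<le> T" for x y
      using that d \<alpha> by (auto intro!: powr_mono2')
    from second_mean_value_theorem[OF int\<phi>[of d T] d(2), of "\<lambda>s. - (s powr - \<alpha>)", OF _ _ this] d
    obtain c where c: "c \<in> {d..T}" and
      eq: "integral {d..T} (\<lambda>x. - (x powr - \<alpha>) * \<phi> x) = - (d powr - \<alpha>) * integral {d..c} \<phi> + - (T powr - \<alpha>) * integral {c..T} \<phi>"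
      by auto
    have c1: "integral {0..d} \<phi> + integral {d..c} \<phi> = integral {0..c} \<phi>"
      using c d by (intro Henstock_Kurzweil_Integration.integral_combine int\<phi>) auto
    have c2: "integral {0..c} \<phi> + integral {c..T} \<phi> = integral {0..T} \<phi>"
      using c d by (intro Henstock_Kurzweil_Integration.integral_combine int\<phi>) auto
    have "norm (integral {0..d} \<phi>) \<le> C * (d - 0)"
      using d C by (intro integral_bound continuous_on_subset[OF \<phi>]) auto
    then have small: "integral {0..d} \<phi> \<le> C * d" by simp
    have "T powr - \<alpha> \<le> d powr - \<alpha>" using d \<alpha> by (intro powr_mono2') auto
    then have "0 \<le> (d powr - \<alpha> - T powr - \<alpha>) * integral {0..c} \<phi>"
      using pos[of c] c d by (intro mult_nonneg_nonneg) auto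
    moreover have "0 \<le> T powr - \<alpha> * integral {0..T} \<phi>" using pos[of T] T by simp
    moreover have "d powr - \<alpha> * integral {0..d} \<phi> \<le> d powr - \<alpha> * (C * d)"
      using small by (intro mult_left_mono) auto
    moreover have "d powr - \<alpha> * (C * d) = C * d powr (1 - \<alpha>)"
      using d powr_add[of d 1 "-\<alpha>"] by simp
    moreover have "integral {d..T} (\<lambda>s. s powr - \<alpha> * \<phi> s) =
       (d powr - \<alpha> - T powr - \<alpha>) * integral {0..c} \<phi> + T powr - \<alpha> * integral {0..T} \<phi> - d powr - \<alpha> * integral {0..d} \<phi>"
    proof -
      have "integral {d..c} \<phi> = integral {0..c} \<phi> - integral {0..d} \<phi>"
        "integral {c..T} \<phi> = integral {0..T} \<phi> - integral {0..c} \<phi>" using c1 c2 by auto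
      with eq show ?thesis by (simp add: algebra_simps)
    qed
    ultimately show ?thesis by linarith
  qed
  have "((\<lambda>d. integral {d..T} (\<lambda>s. s powr - \<alpha> * \<phi> s)) \<longlongrightarrow> integral {0..T} (\<lambda>s. s powr - \<alpha> * \<phi> s)) (at_right 0)"
  proof -
    have "continuous_on {0..T} (\<lambda>d. integral {d..T} (\<lambda>s. s powr - \<alpha> * \<phi> s))"
      using wint by (rule indefinite_integral_continuous_1')
    then have "((\<lambda>d. integral {d..T} (\<lambda>s. s powr - \<alpha> * \<phi> s)) \<longlongrightarrow> integral {0..T} (\<lambda>s. s powr - \<alpha> * \<phi> s)) (at 0 within {0..T})"
      using T by (auto simp: continuous_on_def)
    then show ?thesis using T by (simp add: at_within_Icc_at_right)
  qed
  moreover have "((\<lambda>d. - C * d powr (1 - \<alpha>)) \<longlongrightarrow> 0) (at_right 0)"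
  proof -
    have "((\<lambda>d. - C * d powr (1 - \<alpha>)) \<longlongrightarrow> - C * 0 powr (1 - \<alpha>)) (at_right 0)"
      using \<alpha> by (intro tendsto_intros tendsto_powr') (auto simp: eventually_at_filter)
    then show ?thesis by simp
  qed
  moreover have "\<forall>\<^sub>F d in at_right 0. - C * d powr (1 - \<alpha>) \<le> integral {d..T} (\<lambda>s. s powr - \<alpha> * \<phi> s)"
    using eventually_at_right_less eventually_at_right_field[of "\<lambda>d. - C * d powr (1 - \<alpha>) \<le> integral {d..T} (\<lambda>s. s powr - \<alpha> * \<phi> s)" 0] low T
    by (auto intro!: exI[of _ T])
  ultimately show ?thesis
    by (rule tendsto_le[OF trivial_limit_at_right_real])
qed

text \<open>
  At a maximum of \<open>e\<close> one would like to say that the fractional derivative is nonnegative, which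
  contradicts the hypothesis where \<open>e > 0\<close>; but \<open>e\<close> is only continuous.  The moving integral
  \<open>A s = \<integral>\<^bsub>s-\<epsilon>\<^esub>\<^bsup>s\<^esup> e\<close> is differentiable, and the increment of the memory integral of \<open>e\<close> over \<open>[m-\<epsilon>,m]\<close> is
  the memory integral of \<open>A'\<close>.  At a maximum point \<open>m\<close> of \<open>A\<close> all integrals of \<open>A'\<close> over \<open>[m-s,m]\<close> are
  nonnegative, hence so is this increment, although the hypothesis bounds it by \<open>-\<mu> A m < 0\<close>.
\<close>
lemma memory_comparison:
  fixes e :: "real \<Rightarrow> real"
  assumes \<alpha>: "0 < \<alpha>" "\<alpha> < 1" and \<mu>: "0 < \<mu>"
    and e: "continuous_on UNIV e" "\<And>s. s \<le> 0 \<Longrightarrow> e s = e 0" "e 0 < 0"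
    and diss: "\<And>r t. 0 \<le> r \<Longrightarrow> r \<le> t \<Longrightarrow> t \<le> T \<Longrightarrow>
      memory_integral \<alpha> T e t - memory_integral \<alpha> T e r \<le> - \<mu> * integral {r..t} e"
    and t: "0 \<le> t" "t \<le> T"
  shows "e t \<le> 0"
proof (rule ccontr)
  assume "\<not> e t \<le> 0"
  then have et: "0 < e t" by simp
  have tpos: "0 < t" using t et e(3) by (cases "t = 0") auto
  have cont: "isCont e s" for s using e(1) by (simp add: continuous_on_eq_continuous_at)
  have "\<forall>\<^sub>F s in nhds 0. e s < 0"
    using order_tendstoD(2)[OF cont[of 0, unfolded continuous_at] e(3)] e(3)
    by (simp add: eventually_nhds_conv_at)
  then obtain d1 where d1: "0 < d1" "\<And>s. \<bar>s\<bar> < d1 \<Longrightarrow> e s < 0"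
    by (auto simp: eventually_nhds_metric dist_real_def)
  have "\<forall>\<^sub>F s in nhds t. 0 < e s"
    using order_tendstoD(1)[OF cont[of t, unfolded continuous_at] et] et
    by (simp add: eventually_nhds_conv_at)
  then obtain d2 where d2: "0 < d2" "\<And>s. \<bar>s - t\<bar> < d2 \<Longrightarrow> 0 < e s"
    by (auto simp: eventually_nhds_metric dist_real_def)
  \<comment> \<open>The average over a window of length \<open>\<epsilon>\<close> must be negative up to time \<open>\<epsilon>\<close>, so that the maximum point of \<open>A\<close> lies beyond \<open>\<epsilon>\<close>, and it must be positive at \<open>t\<close>.\<close>
  define \<epsilon> where "\<epsilon> = min d1 d2 / 2"
  have eps: "0 < \<epsilon>" "\<epsilon> < d1" "\<epsilon> < d2" using d1 d2 by (auto simp: \<epsilon>_def min_def)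
  have eint: "e integrable_on {p..r}" for p r
    by (intro integrable_continuous_interval continuous_on_subset[OF e(1)]) auto
  have neg: "e s < 0" if "s \<le> \<epsilon>" for s
    using that eps d1(2)[of s] e(2)[of s] e(3) by (cases "s \<le> 0") auto
  define A where "A s = integral {s - \<epsilon>..s} e" for s
  have Aneg: "A s < 0" if s: "s \<le> \<epsilon>" for s
  proof -
    have "integral {s - \<epsilon>..s} e < integral {s - \<epsilon>..s} (\<lambda>_. 0)"
      using s eps by (intro integral_less_real continuous_intros continuous_on_subset[OF e(1)]) (auto intro!: neg)
    then show ?thesis by (simp add: A_def)
  qed
  have At: "0 < A t"
  proof -
    have "integral {t - \<epsilon>..t} (\<lambda>_. 0) < integral {t - \<epsilon>..t} e"
      using eps by (intro integral_less_real continuous_intros continuous_on_subset[OF e(1)]) (auto intro!: d2)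
    then show ?thesis by (simp add: A_def)
  qed
  have Ader: "(A has_real_derivative e s - e (s - \<epsilon>)) (at s)" for s
  proof -
    define c where "c = s - \<epsilon> - 1"
    have F: "((\<lambda>s. integral {c..s} e) has_real_derivative e z) (at z)" if "c < z" for z
    proof -
      have "((\<lambda>s. integral {c..s} e) has_real_derivative e z) (at z within {c..z + 1})"
        using that by (intro integral_has_real_derivative continuous_on_subset[OF e(1)]) auto
      moreover have "at z within {c..z + 1} = at z"
        using that by (intro at_within_interior) auto
      ultimately show ?thesis by simp
    qed
    have "((\<lambda>s. integral {c..s} e - integral {c..s - \<epsilon>} e) has_real_derivative e s - e (s - \<epsilon>)) (at s)"
      using DERIV_diff[OF F[of s] F[of "s + - \<epsilon>", unfolded DERIV_shift]] eps by (simp add: c_def)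
    then show ?thesis
    proof (rule has_field_derivative_transform_within_open)
      show "open {s - 1<..<s + 1}" "s \<in> {s - 1<..<s + 1}" by auto
      show "integral {c..z} e - integral {c..z - \<epsilon>} e = A z" if "z \<in> {s - 1<..<s + 1}" for z
        using Henstock_Kurzweil_Integration.integral_combine[of c "z - \<epsilon>" z e] eint eps that
        by (auto simp: A_def c_def)
    qed
  qed
  have Acont: "continuous_on {0..t} A"
    using Ader by (auto intro!: continuous_at_imp_continuous_on DERIV_isCont)
  obtain m where m: "m \<in> {0..t}" "\<And>s. s \<in> {0..t} \<Longrightarrow> A s \<le> A m"
    using continuous_attains_sup[OF _ _ Acont] t by auto
  have Am: "0 < A m" using m(2)[of t] At t by auto
  then have m\<epsilon>: "\<epsilon> < m" using Aneg[of m] by force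
  have Amax: "A s \<le> A m" if "s \<le> m" for s
    using that m(2)[of s] m(1) Aneg[of s] Am eps by (cases "0 \<le> s") auto
  let ?\<phi> = "\<lambda>\<sigma>. e (m - \<sigma>) - e (m - \<epsilon> - \<sigma>)"
  have "0 \<le> integral {0..T} (\<lambda>\<sigma>. \<sigma> powr - \<alpha> * ?\<phi> \<sigma>)"
  proof (rule weighted_integral_nonneg[OF \<alpha>])
    show "continuous_on {0..T} ?\<phi>"
      by (intro continuous_intros continuous_on_compose2[OF e(1)]) auto
    show "0 \<le> integral {0..s} ?\<phi>" if "s \<in> {0..T}" for s
    proof -
      have "(?\<phi> has_integral - A (m - s) - - A (m - 0)) {0..s}"
        using that
        by (intro fundamental_theorem_of_calculus)
           (auto intro!: derivative_eq_intros DERIV_chain2[OF Ader]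
              simp: has_real_derivative_iff_has_vector_derivative[symmetric] algebra_simps)
      then show ?thesis using Amax[of "m - s"] that by (simp add: integral_unique)
    qed
  qed (use tpos t in auto)
  also have "\<dots> = memory_integral \<alpha> T e m - memory_integral \<alpha> T e (m - \<epsilon>)"
  proof -
    have "(\<lambda>\<sigma>. \<sigma> powr - \<alpha> * e (m - \<sigma>)) integrable_on {0..T}"
      "(\<lambda>\<sigma>. \<sigma> powr - \<alpha> * e (m - \<epsilon> - \<sigma>)) integrable_on {0..T}"
      using memory_integrable[OF \<alpha>(2) e(1), of 0 T m] memory_integrable[OF \<alpha>(2) e(1), of 0 T "m - \<epsilon>"] t
      by auto
    then show ?thesis
      unfolding memory_integral_def by (simp add: right_diff_distrib integral_diff)
  qed
  also have "\<dots> \<le> - \<mu> * A m"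
    unfolding A_def using m\<epsilon> m(1) t eps by (intro diss) auto
  also have "\<dots> < 0" using \<mu> Am by simp
  finally show False by simp
qed

section \<open>Solutions of the Caputo equation\<close>

lemma integral_reversal:
  fixes F :: "real \<Rightarrow> 'a::euclidean_space"
  shows "integral {0..t} (\<lambda>s. F (t - s)) = integral {0..t} F"
proof -
  have "integral {0..t} F = integral {-t..0} (\<lambda>s. F (- s))"
    using Henstock_Kurzweil_Integration.integral_reflect_real[of t 0 F] by simp
  also have "\<dots> = integral {-t - (-t)..0 - (-t)} (\<lambda>s. F (- (s + (-t))))"
    by (rule integral_shift_real_ivl[symmetric])
  finally show ?thesis by simp
qed

text \<open>
  Memory integrals look back beyond time \<open>0\<close>, where the solution is continued by its initial value.
\<close>
definition with_constant_past :: "(real \<Rightarrow> 'a) \<Rightarrow> real \<Rightarrow> 'a" where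
  "with_constant_past x s = x (max 0 s)"

lemma with_constant_past_nonneg [simp]: "0 \<le> s \<Longrightarrow> with_constant_past x s = x s"
  by (simp add: with_constant_past_def)

lemma with_constant_past_nonpos: "s \<le> 0 \<Longrightarrow> with_constant_past x s = x 0"
  by (simp add: with_constant_past_def)

lemma continuous_with_constant_past:
  assumes "continuous_on {0..} x"
  shows "continuous_on A (with_constant_past x)"
  unfolding with_constant_past_def
  by (intro continuous_on_compose2[OF assms] continuous_intros) auto

lemma caputo_solution_initial:
  "caputo_solution \<alpha> g x0 x \<Longrightarrow> x 0 = x0"
  by (auto simp: caputo_solution_def)

lemma caputo_solution_continuous:
  "caputo_solution \<alpha> g x0 x \<Longrightarrow> continuous_on {0..} x"
  by (simp add: caputo_solution_def)

text \<open>
  The contribution of the forces on \<open>[0,s]\<close> changes by at most \<open>M (t-s)\<^sup>\<alpha> / \<alpha>\<close> before division by \<open>\<Gamma>(\<alpha>)\<close>,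
  and the new forces on \<open>[s,t]\<close> contribute as much again.
\<close>
lemma caputo_solution_holder:
  fixes g :: "real ^ 'd \<Rightarrow> real ^ 'd"
  assumes \<alpha>: "0 < \<alpha>" "\<alpha> < 1" and sol: "caputo_solution \<alpha> g x0 x" and g: "continuous_on UNIV g"
    and M: "\<And>s. 0 \<le> s \<Longrightarrow> s \<le> t \<Longrightarrow> norm (g (x s)) \<le> M" and st: "0 \<le> s" "s \<le> t"
  shows "norm (x t - x s) \<le> 2 * M / (\<alpha> * Gamma \<alpha>) * (t - s) powr \<alpha>"
proof -
  let ?f = "\<lambda>r. g (x r)" and ?k = "\<lambda>t r. (t - r) powr (\<alpha> - 1)"
  have fc: "continuous_on {p..q} ?f" if "0 \<le> p" for p q
    using that by (intro continuous_on_compose2[OF g] continuous_on_subset[OF caputo_solution_continuous[OF sol]]) auto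
  have int: "(\<lambda>r. ?k c r *\<^sub>R ?f r) integrable_on {p..q}" if "0 \<le> p" "p \<le> q" "q \<le> c" for p q c
    using has_integral_powr_kernel[OF \<alpha>(1) that(2,3)] that
    by (intro nonneg_kernel_integrable fc) auto
  have \<Gamma>: "0 < Gamma \<alpha>" using \<alpha> by (intro Gamma_real_pos)
  have x: "x c = x0 + (1 / Gamma \<alpha>) *\<^sub>R integral {0..c} (\<lambda>r. ?k c r *\<^sub>R ?f r)" if "0 \<le> c" for c
    using sol that by (simp add: caputo_solution_def)
  have split: "integral {0..t} (\<lambda>r. ?k t r *\<^sub>R ?f r) =
      integral {0..s} (\<lambda>r. ?k t r *\<^sub>R ?f r) + integral {s..t} (\<lambda>r. ?k t r *\<^sub>R ?f r)"
    using st by (intro Henstock_Kurzweil_Integration.integral_combine[symmetric] int) auto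
  have old: "norm (integral {0..s} (\<lambda>r. (?k s r - ?k (s + (t - s)) r) *\<^sub>R ?f r)) \<le> M * ((t - s) powr \<alpha> / \<alpha>)"
    using st by (intro powr_kernel_difference_bound \<alpha> fc M) auto
  have old_eq: "integral {0..s} (\<lambda>r. (?k s r - ?k (s + (t - s)) r) *\<^sub>R ?f r) =
      integral {0..s} (\<lambda>r. ?k s r *\<^sub>R ?f r) - integral {0..s} (\<lambda>r. ?k t r *\<^sub>R ?f r)"
    unfolding scaleR_diff_left using st by (subst integral_diff) (auto intro!: int)
  have new: "norm (integral {s..t} (\<lambda>r. ?k t r *\<^sub>R ?f r)) \<le> M * ((t - s) powr \<alpha> / \<alpha>)"
    using has_integral_powr_kernel[OF \<alpha>(1) st(2) order_refl] st
    by (intro nonneg_kernel_norm_bound fc M) auto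
  have "x t - x s = (1 / Gamma \<alpha>) *\<^sub>R (integral {s..t} (\<lambda>r. ?k t r *\<^sub>R ?f r)
      - integral {0..s} (\<lambda>r. (?k s r - ?k (s + (t - s)) r) *\<^sub>R ?f r))"
    unfolding old_eq using x[of t] x[of s] st split by (simp add: algebra_simps)
  then have "norm (x t - x s) = (1 / Gamma \<alpha>) * norm (integral {s..t} (\<lambda>r. ?k t r *\<^sub>R ?f r)
      - integral {0..s} (\<lambda>r. (?k s r - ?k (s + (t - s)) r) *\<^sub>R ?f r))"
    using \<Gamma> by simp
  also have "\<dots> \<le> (1 / Gamma \<alpha>) * (M * ((t - s) powr \<alpha> / \<alpha>) + M * ((t - s) powr \<alpha> / \<alpha>))"
    using \<Gamma> by (intro mult_left_mono order_trans[OF norm_triangle_ineq4] add_mono old new) auto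
  also have "\<dots> = 2 * M / (\<alpha> * Gamma \<alpha>) * (t - s) powr \<alpha>" by (simp add: algebra_simps)
  finally show ?thesis .
qed

text \<open>
  This is the differential form \<open>D\<^sup>\<alpha> x = g x\<close> of the equation, integrated over \<open>[r,t]\<close>: applying the
  fractional integral of order \<open>1 - \<alpha>\<close> to \<open>x - x0\<close> undoes the one of order \<open>\<alpha>\<close>.
\<close>
lemma caputo_solution_memory_increment:
  fixes g :: "real ^ 'd \<Rightarrow> real ^ 'd"
  assumes \<alpha>: "0 < \<alpha>" "\<alpha> < 1" and sol: "caputo_solution \<alpha> g x0 x" and g: "continuous_on UNIV g"
    and rt: "0 \<le> r" "r \<le> t" "t \<le> T"
  shows "memory_integral \<alpha> T (with_constant_past x) t - memory_integral \<alpha> T (with_constant_past x) r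
    = Gamma (1 - \<alpha>) *\<^sub>R integral {r..t} (\<lambda>s. g (x s))"
proof -
  let ?y = "with_constant_past x"
  have yc: "continuous_on A ?y" for A
    by (rule continuous_with_constant_past[OF caputo_solution_continuous[OF sol]])
  have fc: "continuous_on A (\<lambda>s. g (?y s))" for A
    by (intro continuous_on_compose2[OF g] yc) auto
  have \<Gamma>: "0 < Gamma \<alpha>" using \<alpha> by (intro Gamma_real_pos)
  have main: "memory_integral \<alpha> T ?y c = memory_integral \<alpha> T (\<lambda>_. x0) 0 + Gamma (1 - \<alpha>) *\<^sub>R integral {0..c} (\<lambda>s. g (?y s))"
    if c: "0 \<le> c" "c \<le> T" for c
  proof -
    \<comment> \<open>Only the deviation from the initial value carries information; it vanishes for \<open>s \<le> 0\<close>, which shortens the integration to \<open>[0,c]\<close>.\<close>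
    let ?q = "\<lambda>s. ?y s - x0"
    let ?k = "\<lambda>\<sigma>. \<sigma> powr - \<alpha> *\<^sub>R ?q (c - \<sigma>)"
    have q0: "?q s = 0" if "s \<le> 0" for s
      using that caputo_solution_initial[OF sol] by (simp add: with_constant_past_nonpos)
    have "memory_integral \<alpha> T ?q c = integral {0..c} ?k + integral {c..T} ?k"
      unfolding memory_integral_def using c \<alpha>
      by (intro Henstock_Kurzweil_Integration.integral_combine[symmetric] memory_integrable continuous_intros yc) auto
    also have "integral {c..T} ?k = integral {c..T} (\<lambda>_. 0)"
      by (rule Henstock_Kurzweil_Integration.integral_cong) (simp add: q0)
    also have "integral {0..c} ?k = integral {0..c} (\<lambda>s. (c - s) powr - \<alpha> *\<^sub>R ?q s)"
      using integral_reversal[of c ?k] by simp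
    also have "\<dots> = integral {0..c} (\<lambda>s. (1 / Gamma \<alpha>) *\<^sub>R
        ((c - s) powr - \<alpha> *\<^sub>R integral {0..s} (\<lambda>r. (s - r) powr (\<alpha> - 1) *\<^sub>R g (?y r))))"
    proof (rule Henstock_Kurzweil_Integration.integral_cong)
      fix s assume s: "s \<in> {0..c}"
      have "integral {0..s} (\<lambda>r. (s - r) powr (\<alpha> - 1) *\<^sub>R g (?y r)) = integral {0..s} (\<lambda>r. (s - r) powr (\<alpha> - 1) *\<^sub>R g (x r))"
        by (rule Henstock_Kurzweil_Integration.integral_cong) simp
      moreover have "?q s = (1 / Gamma \<alpha>) *\<^sub>R integral {0..s} (\<lambda>r. (s - r) powr (\<alpha> - 1) *\<^sub>R g (x r))"
        using sol s by (auto simp: caputo_solution_def)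
      ultimately show "(c - s) powr - \<alpha> *\<^sub>R ?q s = (1 / Gamma \<alpha>) *\<^sub>R
        ((c - s) powr - \<alpha> *\<^sub>R integral {0..s} (\<lambda>r. (s - r) powr (\<alpha> - 1) *\<^sub>R g (?y r)))"
        by (simp add: mult.commute)
    qed
    also have "\<dots> = (1 / Gamma \<alpha>) *\<^sub>R (Gamma \<alpha> * Gamma (1 - \<alpha>)) *\<^sub>R integral {0..c} (\<lambda>s. g (?y s))"
      by (simp only: integral_cmul fractional_integral_inversion[OF \<alpha> c(1) fc])
    finally have q: "memory_integral \<alpha> T ?q c = Gamma (1 - \<alpha>) *\<^sub>R integral {0..c} (\<lambda>s. g (?y s))"
      using \<Gamma> by simp
    have "memory_integral \<alpha> T ?y c = memory_integral \<alpha> T (\<lambda>_. x0) c + memory_integral \<alpha> T ?q c"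
      using memory_integral_add[of \<alpha> "\<lambda>_. x0" ?q T c] \<alpha> c
      by (simp add: continuous_intros yc)
    then show ?thesis using q memory_integral_const[of \<alpha> T x0 c 0] by simp
  qed
  have "integral {0..r} (\<lambda>s. g (?y s)) + integral {r..t} (\<lambda>s. g (?y s)) = integral {0..t} (\<lambda>s. g (?y s))"
    using rt by (intro Henstock_Kurzweil_Integration.integral_combine integrable_continuous_interval fc) auto
  moreover have "integral {r..t} (\<lambda>s. g (?y s)) = integral {r..t} (\<lambda>s. g (x s))"
    by (rule Henstock_Kurzweil_Integration.integral_cong) (use rt in auto)
  ultimately show ?thesis
    using main[of t] main[of r] rt by (simp add: algebra_simps flip: scaleR_add_right)
qed

section \<open>Energy inequality and absorption\<close>

text \<open>
  On a partition of \<open>[r,t]\<close> into \<open>n\<close> equal steps the increments add up to at most a constant times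
  \<open>n \<cdot> n\<^sup>-\<^sup>1\<^sup>-\<^sup>\<alpha> = n\<^sup>-\<^sup>\<alpha>\<close>.
\<close>
lemma antimono_of_superlinear_increments:
  fixes \<Phi> :: "real \<Rightarrow> real"
  assumes \<alpha>: "0 < \<alpha>" and rt: "0 \<le> r" "r \<le> t" "t \<le> T"
    and inc: "\<And>r t. 0 \<le> r \<Longrightarrow> r \<le> t \<Longrightarrow> t \<le> T \<Longrightarrow> \<Phi> t - \<Phi> r \<le> C * (t - r) powr (1 + \<alpha>)"
  shows "\<Phi> t \<le> \<Phi> r"
proof -
  define D where "D = C * (t - r) powr (1 + \<alpha>)"
  have bound: "\<Phi> t - \<Phi> r \<le> D * real n powr - \<alpha>" if n: "0 < n" for n
  proof -
    define p where "p i = r + real i * ((t - r) / real n)" for i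
    have p0: "p 0 = r" and pn: "p n = t" using n by (auto simp: p_def)
    have step: "\<Phi> (p (Suc i)) - \<Phi> (p i) \<le> C * ((t - r) / real n) powr (1 + \<alpha>)" if "i < n" for i
    proof -
      have diff: "p (Suc i) - p i = (t - r) / real n" 
        by (simp add: p_def algebra_simps add_divide_distrib diff_divide_distrib)
      have ge: "0 \<le> (t - r) / real n" using rt by simp
      have "p (Suc i) \<le> p n"
        unfolding p_def using that ge by (intro add_left_mono mult_right_mono) auto
      moreover have "0 \<le> p i" using rt ge by (auto simp: p_def)
      ultimately show ?thesis
        using inc[of "p i" "p (Suc i)"] diff ge rt pn by auto
    qed
    have "\<Phi> t - \<Phi> r = (\<Sum>i<n. \<Phi> (p (Suc i)) - \<Phi> (p i))"
      using sum_lessThan_telescope[of "\<lambda>i. \<Phi> (p i)" n] by (simp add: p0 pn)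
    also have "\<dots> \<le> (\<Sum>i<n. C * ((t - r) / real n) powr (1 + \<alpha>))"
      by (intro sum_mono step) auto
    also have "\<dots> = D * (real n * (1 / real n powr (1 + \<alpha>)))"
      using rt by (simp add: D_def powr_divide)
    also have "real n * (1 / real n powr (1 + \<alpha>)) = real n powr - \<alpha>"
      using n by (simp add: powr_add powr_minus divide_simps)
    finally show ?thesis .
  qed
  have "(\<lambda>n. D * real n powr - \<alpha>) \<longlonglongrightarrow> D * 0"
    using \<alpha> by (intro tendsto_mult tendsto_const tendsto_neg_powr filterlim_real_sequentially) auto
  then have "\<Phi> t - \<Phi> r \<le> D * 0"
    by (rule LIMSEQ_le_const) (use bound in \<open>auto intro!: exI[of _ 1]\<close>)
  then show ?thesis by simp
qed

text \<open>
  Expanding \<open>q s = (norm (x s - x t))\<^sup>2\<close> splits the increment for \<open>u\<close> over \<open>[t-h,t]\<close> into \<open>2 x t\<close> times the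
  increment for \<open>x\<close> plus the increment for \<open>q\<close>.  The latter is \<open>O(h\<^sup>1\<^sup>+\<^sup>\<alpha>)\<close> because \<open>x\<close> is Hoelder
  continuous of order \<open>\<alpha>\<close>, and freezing \<open>x t\<close> instead of \<open>x s\<close> under the integral costs another
  \<open>O(h\<^sup>1\<^sup>+\<^sup>\<alpha>)\<close>.
\<close>
lemma caputo_solution_energy_inequality:
  fixes g :: "real ^ 'd \<Rightarrow> real ^ 'd"
  assumes \<alpha>: "0 < \<alpha>" "\<alpha> < 1" and sol: "caputo_solution \<alpha> g x0 x" and g: "continuous_on UNIV g"
    and rt: "0 \<le> r" "r \<le> t" "t \<le> T"
  shows "memory_integral \<alpha> T (\<lambda>s. (norm (with_constant_past x s))\<^sup>2) t
      - memory_integral \<alpha> T (\<lambda>s. (norm (with_constant_past x s))\<^sup>2) r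
    \<le> 2 * Gamma (1 - \<alpha>) * integral {r..t} (\<lambda>s. x s \<bullet> g (x s))"
proof -
  let ?y = "with_constant_past x" and ?\<Gamma> = "Gamma (1 - \<alpha>)"
  let ?u = "\<lambda>s. (norm (?y s))\<^sup>2"
  let ?w = "\<lambda>s. ?y s \<bullet> g (?y s)"
  have T: "0 \<le> T" using rt by simp
  have yc: "continuous_on A ?y" for A
    by (rule continuous_with_constant_past[OF caputo_solution_continuous[OF sol]])
  have fc: "continuous_on A (\<lambda>s. g (?y s))" for A
    by (intro continuous_on_compose2[OF g] yc) auto
  have wint: "?w integrable_on {p..q}" for p q
    by (intro integrable_continuous_interval continuous_intros yc fc)
  have \<Gamma>: "0 < Gamma \<alpha>" "0 < ?\<Gamma>" using \<alpha> by (auto intro: Gamma_real_pos)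
  have "bounded ((\<lambda>s. g (?y s)) ` {0..T})"
    by (intro compact_imp_bounded compact_continuous_image fc) auto
  then obtain M where M: "0 < M" "\<forall>s\<in>{0..T}. norm (g (?y s)) \<le> M"
    unfolding bounded_pos by blast
  define H where "H = 2 * M / (\<alpha> * Gamma \<alpha>)"
  have H: "0 \<le> H" using \<alpha> \<Gamma> M by (simp add: H_def)
  have holder: "norm (?y c - ?y s) \<le> H * (c - s) powr \<alpha>" if "0 \<le> s" "s \<le> c" "c \<le> T" for s c
    using caputo_solution_holder[OF \<alpha> sol g _ that(1,2), of M] M that by (simp add: H_def)
  define C where "C = H\<^sup>2 / (1 + \<alpha>) + 2 * ?\<Gamma> * (H * M)"
  define \<Phi> where "\<Phi> c = memory_integral \<alpha> T ?u c - 2 * ?\<Gamma> * integral {0..c} ?w" for c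
  have \<Phi>_diff: "\<Phi> t - \<Phi> r = memory_integral \<alpha> T ?u t - memory_integral \<alpha> T ?u r - 2 * (?\<Gamma> * integral {r..t} ?w)"
    if "0 \<le> r" "r \<le> t" for r t
  proof -
    have "integral {0..r} ?w + integral {r..t} ?w = integral {0..t} ?w"
      using that by (intro Henstock_Kurzweil_Integration.integral_combine wint) auto
    then show ?thesis by (simp add: \<Phi>_def algebra_simps flip: distrib_left)
  qed
  have "\<Phi> t \<le> \<Phi> r"
  proof (rule antimono_of_superlinear_increments[OF \<alpha>(1) rt])
    fix r t assume rt: "0 \<le> r" "r \<le> t" "t \<le> T"
    define h where "h = t - r"
    have h: "0 \<le> h" "h \<le> T" "t - h = r" using rt by (auto simp: h_def)
    let ?q = "\<lambda>s. (norm (?y s - ?y t))\<^sup>2"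
    have incr: "memory_integral \<alpha> T ?q t - memory_integral \<alpha> T ?q (t - h) \<le> H\<^sup>2 * (h powr (1 + \<alpha>) / (1 + \<alpha>))"
    proof (rule memory_integral_increment_le[OF \<alpha> h(1,2)])
      show "?q (t - \<sigma>) \<le> H\<^sup>2 * \<sigma> powr (2 * \<alpha>)" if "0 \<le> \<sigma>" "\<sigma> \<le> h" for \<sigma>
      proof -
        have "norm (?y (t - \<sigma>) - ?y t) \<le> H * \<sigma> powr \<alpha>"
          using holder[of "t - \<sigma>" t] that rt by (simp add: norm_minus_commute h_def)
        then have "?q (t - \<sigma>) \<le> (H * \<sigma> powr \<alpha>)\<^sup>2" by (intro power_mono) auto
        moreover have "(\<sigma> powr \<alpha>)\<^sup>2 = \<sigma> powr (2 * \<alpha>)"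
          unfolding power2_eq_square powr_add[symmetric] by simp
        then have "(H * \<sigma> powr \<alpha>)\<^sup>2 = H\<^sup>2 * \<sigma> powr (2 * \<alpha>)"
          unfolding power_mult_distrib by simp
        ultimately show ?thesis by simp
      qed
    qed (auto intro!: continuous_intros yc)
    have expand: "memory_integral \<alpha> T ?q c =
        memory_integral \<alpha> T ?u c + memory_integral \<alpha> T (\<lambda>_. (norm (?y t))\<^sup>2) 0
          - 2 * (?y t \<bullet> memory_integral \<alpha> T ?y c)" for c
    proof -
      have "?q = (\<lambda>s. (?u s + (norm (?y t))\<^sup>2) - (2 *\<^sub>R ?y t) \<bullet> ?y s)"
        
        unfolding fun_eq_iff power2_norm_eq_inner
        by (simp add: inner_diff_left inner_diff_right inner_commute)
      then have "memory_integral \<alpha> T ?q c = memory_integral \<alpha> T (\<lambda>s. (?u s + (norm (?y t))\<^sup>2) - (2 *\<^sub>R ?y t) \<bullet> ?y s) c"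
        by simp
      also have "\<dots> = memory_integral \<alpha> T (\<lambda>s. ?u s + (norm (?y t))\<^sup>2) c
          - memory_integral \<alpha> T (\<lambda>s. (2 *\<^sub>R ?y t) \<bullet> ?y s) c"
        using \<alpha> T by (intro memory_integral_diff continuous_intros yc)
      also have "memory_integral \<alpha> T (\<lambda>s. ?u s + (norm (?y t))\<^sup>2) c =
          memory_integral \<alpha> T ?u c + memory_integral \<alpha> T (\<lambda>_. (norm (?y t))\<^sup>2) c"
        using \<alpha> T by (intro memory_integral_add continuous_intros yc)
      also have "memory_integral \<alpha> T (\<lambda>s. (2 *\<^sub>R ?y t) \<bullet> ?y s) c = (2 *\<^sub>R ?y t) \<bullet> memory_integral \<alpha> T ?y c"
        by (rule memory_integral_linear[OF \<alpha>(2) yc T bounded_linear_inner_right])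
      finally show ?thesis using memory_integral_const[of \<alpha> T "(norm (?y t))\<^sup>2" c 0] by simp
    qed
    have cross: "?y t \<bullet> memory_integral \<alpha> T ?y t - ?y t \<bullet> memory_integral \<alpha> T ?y r
        \<le> ?\<Gamma> * (integral {r..t} ?w + H * M * h powr (1 + \<alpha>))"
    proof -
      have "integral {r..t} (\<lambda>s. g (x s)) = integral {r..t} (\<lambda>s. g (?y s))"
        by (rule Henstock_Kurzweil_Integration.integral_cong) (use rt in auto)
      then have "?y t \<bullet> memory_integral \<alpha> T ?y t - ?y t \<bullet> memory_integral \<alpha> T ?y r
          = ?\<Gamma> * (?y t \<bullet> integral {r..t} (\<lambda>s. g (?y s)))"
        using caputo_solution_memory_increment[OF \<alpha> sol g rt] by (simp flip: inner_diff_right)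
      also have "?y t \<bullet> integral {r..t} (\<lambda>s. g (?y s)) = integral {r..t} (\<lambda>s. ?y t \<bullet> g (?y s))"
        using integral_linear[OF integrable_continuous_interval[OF fc] bounded_linear_inner_right, of r t "?y t"]
        by (simp add: o_def)
      also have "\<dots> \<le> integral {r..t} (\<lambda>s. ?w s + H * M * h powr \<alpha>)"
      proof (rule integral_le)
        show "?y t \<bullet> g (?y s) \<le> ?w s + H * M * h powr \<alpha>" if s: "s \<in> {r..t}" for s
        proof -
          have "?y t \<bullet> g (?y s) - ?w s = (?y t - ?y s) \<bullet> g (?y s)" by (simp add: inner_diff_left)
          also have "\<dots> \<le> norm (?y t - ?y s) * norm (g (?y s))" by (rule norm_cauchy_schwarz)
          also have "\<dots> \<le> (H * (t - s) powr \<alpha>) * M"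
            using s rt M H by (intro mult_mono holder) auto
          also have "\<dots> \<le> (H * h powr \<alpha>) * M"
            using s rt M H \<alpha> by (intro mult_right_mono mult_left_mono powr_mono2) (auto simp: h_def)
          finally show ?thesis by (simp add: algebra_simps)
        qed
      qed (intro integrable_continuous_interval continuous_intros yc fc)+
      also have "\<dots> = integral {r..t} ?w + H * M * (h * h powr \<alpha>)"
        using rt by (subst integral_add) (auto intro!: wint simp: h_def)
      also have "h * h powr \<alpha> = h powr (1 + \<alpha>)"
        using h(1) by (simp add: powr_add)
      finally show ?thesis using \<Gamma> by simp
    qed
    have "memory_integral \<alpha> T ?u t - memory_integral \<alpha> T ?u r
        \<le> H\<^sup>2 * (h powr (1 + \<alpha>) / (1 + \<alpha>)) + 2 * (?\<Gamma> * (integral {r..t} ?w + H * M * h powr (1 + \<alpha>)))"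
      using incr expand[of t] expand[of r] cross unfolding h(3) by linarith
    moreover have "C * (t - r) powr (1 + \<alpha>) = H\<^sup>2 * (h powr (1 + \<alpha>) / (1 + \<alpha>)) + 2 * (?\<Gamma> * (H * M * h powr (1 + \<alpha>)))"
      by (simp add: C_def h_def algebra_simps)
    ultimately show "\<Phi> t - \<Phi> r \<le> C * (t - r) powr (1 + \<alpha>)"
      using \<Phi>_diff[OF rt(1,2)] by (simp add: distrib_left)
  qed
  moreover have "integral {r..t} ?w = integral {r..t} (\<lambda>s. x s \<bullet> g (x s))"
    by (rule Henstock_Kurzweil_Integration.integral_cong) (use rt in auto)
  ultimately show ?thesis using \<Phi>_diff[OF rt(1,2)] by simp
qed

text \<open>
  The comparison principle is applied to \<open>u\<close> minus a barrier \<open>a/b + v\<close>, where \<open>v\<close> falls linearly from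
  \<open>1 + R\<^sup>2\<close> to \<open>1\<close> on \<open>[0,T]\<close>.  While \<open>v \<ge> 1\<close>, the damping \<open>-2b u\<close> exceeds the forcing \<open>2a\<close> by at least
  \<open>2b\<close> on the barrier, and the hypothesis on \<open>T\<close> keeps the memory integral of \<open>v\<close> from decreasing faster
  than this surplus, multiplied by \<open>\<Gamma>(1 - \<alpha>)\<close>, allows.
\<close>
lemma caputo_solution_absorption:
  fixes g :: "real ^ 'd \<Rightarrow> real ^ 'd"
  assumes \<alpha>: "0 < \<alpha>" "\<alpha> < 1" and sol: "caputo_solution \<alpha> g x0 x" and g: "continuous_on UNIV g"
    and ab: "0 < a" "0 < b" and diss: "\<And>x. x \<bullet> g x \<le> a - b * (norm x)\<^sup>2"
    and x0: "norm x0 \<le> R" and T: "0 < T" "R\<^sup>2 / (1 - \<alpha>) * T powr - \<alpha> \<le> 2 * b * Gamma (1 - \<alpha>)"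
    and t: "0 \<le> t" "t \<le> T"
  shows "(norm (x t))\<^sup>2 \<le> a / b + 1 + R\<^sup>2 * (1 - t / T)"
proof -
  let ?y = "with_constant_past x" and ?\<Gamma> = "Gamma (1 - \<alpha>)"
  let ?u = "\<lambda>s. (norm (?y s))\<^sup>2"
  define v where "v s = 1 + R\<^sup>2 * (1 - max 0 s / T)" for s
  define e where "e s = ?u s - (a / b + v s)" for s
  have yc: "continuous_on A ?y" for A
    by (rule continuous_with_constant_past[OF caputo_solution_continuous[OF sol]])
  have uc: "continuous_on A ?u" for A by (intro continuous_intros yc)
  have vc: "continuous_on A v" for A unfolding v_def using T by (intro continuous_intros) auto
  have ec: "continuous_on A e" for A unfolding e_def by (intro continuous_intros uc vc)
  have \<Gamma>: "0 < ?\<Gamma>" using \<alpha> by (auto intro: Gamma_real_pos)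
  have "e t \<le> 0"
  proof (rule memory_comparison[OF \<alpha> _ ec _ _ _ t])
    show "0 < 2 * b * ?\<Gamma>" using ab \<Gamma> by simp
    show "e s = e 0" if "s \<le> 0" for s
      using that by (simp add: e_def v_def with_constant_past_nonpos)
    have "(norm x0)\<^sup>2 \<le> R\<^sup>2" using x0 by (intro power_mono) auto
    moreover have "0 < a / b" using ab by simp
    ultimately show "e 0 < 0"
      using caputo_solution_initial[OF sol] by (simp add: e_def v_def)
  next
    fix r t assume rt: "0 \<le> r" "r \<le> t" "t \<le> T"
    have v1: "1 \<le> v s" if "s \<le> T" for s
      using that T by (simp add: v_def)
    have barrier: "memory_integral \<alpha> T v r - memory_integral \<alpha> T v t \<le> 2 * b * ?\<Gamma> * (t - r)"
    proof -
      have "memory_integral \<alpha> T v r - memory_integral \<alpha> T v t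
          = integral {0..T} (\<lambda>\<sigma>. \<sigma> powr - \<alpha> *\<^sub>R v (r - \<sigma>) - \<sigma> powr - \<alpha> *\<^sub>R v (t - \<sigma>))"
        unfolding memory_integral_def using \<alpha> T by (intro integral_diff[symmetric] memory_integrable vc) auto
      also have "\<dots> \<le> integral {0..T} (\<lambda>\<sigma>. R\<^sup>2 * (t - r) / T * \<sigma> powr - \<alpha>)"
      proof (rule integral_le)
        show "(\<lambda>\<sigma>. \<sigma> powr - \<alpha> *\<^sub>R v (r - \<sigma>) - \<sigma> powr - \<alpha> *\<^sub>R v (t - \<sigma>)) integrable_on {0..T}"
          using \<alpha> T by (intro integrable_diff memory_integrable vc) auto
        show "(\<lambda>\<sigma>. R\<^sup>2 * (t - r) / T * \<sigma> powr - \<alpha>) integrable_on {0..T}"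
          using \<alpha> T by (intro integrable_on_mult_right integrable_on_powr_from_0) auto
        show "\<sigma> powr - \<alpha> *\<^sub>R v (r - \<sigma>) - \<sigma> powr - \<alpha> *\<^sub>R v (t - \<sigma>) \<le> R\<^sup>2 * (t - r) / T * \<sigma> powr - \<alpha>"
          for \<sigma>
        proof -
          have "v (r - \<sigma>) - v (t - \<sigma>) = R\<^sup>2 / T * (max 0 (t - \<sigma>) - max 0 (r - \<sigma>))"
            by (simp add: v_def algebra_simps diff_divide_distrib)
          also have "\<dots> \<le> R\<^sup>2 / T * (t - r)"
            using rt T by (intro mult_left_mono) auto
          finally have "\<sigma> powr - \<alpha> * (v (r - \<sigma>) - v (t - \<sigma>)) \<le> \<sigma> powr - \<alpha> * (R\<^sup>2 / T * (t - r))"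
            by (intro mult_left_mono) auto
          then show ?thesis by (simp add: algebra_simps)
        qed
      qed
      also have "\<dots> = R\<^sup>2 * (t - r) / T * (T powr (1 - \<alpha>) / (1 - \<alpha>))"
        using has_integral_powr_from_0[of "- \<alpha>" T] \<alpha> T by (simp add: integral_unique)
      also have "\<dots> = R\<^sup>2 / (1 - \<alpha>) * T powr - \<alpha> * (t - r)"
        using T powr_add[of T 1 "- \<alpha>"] by simp
      also have "\<dots> \<le> 2 * b * ?\<Gamma> * (t - r)"
        using T rt by (intro mult_right_mono) auto
      finally show ?thesis .
    qed
    have split: "memory_integral \<alpha> T e c = memory_integral \<alpha> T ?u c
        - (memory_integral \<alpha> T (\<lambda>_. a / b) 0 + memory_integral \<alpha> T v c)" for c
    proof -
      have "memory_integral \<alpha> T e c = memory_integral \<alpha> T ?u c - memory_integral \<alpha> T (\<lambda>s. a / b + v s) c"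
        unfolding e_def using \<alpha> T by (intro memory_integral_diff continuous_intros uc vc) auto
      also have "memory_integral \<alpha> T (\<lambda>s. a / b + v s) c = memory_integral \<alpha> T (\<lambda>_. a / b) c + memory_integral \<alpha> T v c"
        using \<alpha> T by (intro memory_integral_add continuous_intros vc) auto
      also have "memory_integral \<alpha> T (\<lambda>_. a / b) c = memory_integral \<alpha> T (\<lambda>_. a / b) 0"
        by (rule memory_integral_const)
      finally show ?thesis .
    qed
    have "integral {r..t} (\<lambda>s. x s \<bullet> g (x s)) \<le> integral {r..t} (\<lambda>s. b * (- e s - 1))"
    proof (rule integral_le)
      have "continuous_on {r..t} (\<lambda>s. ?y s \<bullet> g (?y s))"
        by (intro continuous_intros yc continuous_on_compose2[OF g]) auto
      then have "continuous_on {r..t} (\<lambda>s. x s \<bullet> g (x s))"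
        by (rule continuous_on_eq) (use rt in auto)
      then show "(\<lambda>s. x s \<bullet> g (x s)) integrable_on {r..t}"
        by (rule integrable_continuous_interval)
      show "(\<lambda>s. b * (- e s - 1)) integrable_on {r..t}"
        by (intro integrable_continuous_interval continuous_intros ec)
      show "x s \<bullet> g (x s) \<le> b * (- e s - 1)" if "s \<in> {r..t}" for s
      proof -
        have "b * (norm (x s))\<^sup>2 - a = b * (e s + v s)"
          using that rt ab by (simp add: e_def field_simps)
        moreover have "b * 1 \<le> b * v s" using v1[of s] that rt ab by (intro mult_left_mono) auto
        ultimately show ?thesis using diss[of "x s"] by (simp add: algebra_simps)
      qed
    qed
    also have "\<dots> = integral {r..t} (\<lambda>s. - b * e s - b)" by (simp add: algebra_simps)
    also have "\<dots> = - b * integral {r..t} e - b * (t - r)"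
      using rt by (subst integral_diff) (auto intro!: integrable_continuous_interval continuous_intros ec)
    finally have "2 * ?\<Gamma> * integral {r..t} (\<lambda>s. x s \<bullet> g (x s)) \<le> 2 * ?\<Gamma> * (- b * integral {r..t} e - b * (t - r))"
      using \<Gamma> by (intro mult_left_mono) auto
    with caputo_solution_energy_inequality[OF \<alpha> sol g rt] barrier
    show "memory_integral \<alpha> T e t - memory_integral \<alpha> T e r \<le> - (2 * b * ?\<Gamma>) * integral {r..t} e"
      unfolding split by (simp add: algebra_simps)
  qed
  then show ?thesis using t by (simp add: e_def v_def)
qed

section \<open>The equicontinuity estimate\<close>

text \<open>
  The factor \<open>sqrt d \<ge> 1\<close> in \<^const>\<open>G_star\<close> is discarded.  Continuity of \<open>g\<close> on the compact ball is what
  makes the supremum an upper bound at all.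
\<close>
lemma G_star_upper:
  fixes g :: "real ^ 'd \<Rightarrow> real ^ 'd"
  assumes g: "continuous_on UNIV g" and x: "x \<in> B_star a b"
  shows "norm (g x) \<le> G_star g a b"
proof -
  let ?s = "\<lambda>x. sqrt (real CARD('d)) * norm (g x)"
  have "compact (?s ` cball 0 (delta_star a b))"
    by (intro compact_continuous_image continuous_intros continuous_on_subset[OF g]) auto
  moreover have "B_star a b = (cball 0 (delta_star a b) :: (real ^ 'd) set)"
    by (auto simp: B_star_def)
  ultimately have "bdd_above (?s ` B_star a b)"
    by (simp add: bounded_imp_bdd_above compact_imp_bounded)
  then have "?s x \<le> G_star g a b"
    unfolding G_star_def using x by (intro cSUP_upper)
  moreover have "1 * norm (g x) \<le> ?s x"
    by (intro mult_right_mono) auto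
  ultimately show ?thesis by linarith
qed

text \<open>
  At a point with \<open>(norm z)\<^sup>2 = a/b + 1\<close>, on the boundary of \<^const>\<open>B_star\<close>, dissipativity gives
  \<open>z \<bullet> g z \<le> -b\<close>, hence \<open>g z \<noteq> 0\<close>.
\<close>
lemma G_star_pos:
  fixes g :: "real ^ 'd \<Rightarrow> real ^ 'd"
  assumes g: "continuous_on UNIV g" and ab: "0 < a" "0 < b"
    and diss: "\<And>x. x \<bullet> g x \<le> a - b * (norm x)\<^sup>2"
  shows "0 < G_star g a b"
proof -
  obtain i :: 'd where True by simp
  define z :: "real ^ 'd" where "z = delta_star a b *\<^sub>R axis i 1"
  have d: "0 \<le> delta_star a b" "(delta_star a b)\<^sup>2 = a / b + 1"
    using ab by (auto simp: delta_star_def)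
  then have nz: "norm z = delta_star a b" by (simp add: z_def)
  have "z \<bullet> g z \<le> - b"
    using diss[of z] ab unfolding nz d(2) by (simp add: field_simps)
  then have "g z \<noteq> 0" using ab by auto
  moreover have "norm (g z) \<le> G_star g a b"
    using nz by (intro G_star_upper g) (simp add: B_star_def)
  ultimately show ?thesis using zero_less_norm_iff[of "g z"] by linarith
qed

theorem proposition4p4:
  fixes g :: "real ^ 'd \<Rightarrow> real ^ 'd" and \<alpha> a b R :: real
  assumes "0 < \<alpha>" and "\<alpha> < 1"
    and "0 < a" and "0 < b"
    and "locally_lipschitz g"
    and "\<And>x. x \<bullet> g x \<le> a - b * (norm x)\<^sup>2"
    and "0 < R"
  shows "\<exists>T>0. \<forall>x0 x. norm x0 \<le> R \<and> caputo_solution \<alpha> g x0 x \<longrightarrow>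
    (\<forall>\<theta>1 \<theta>2 t. 0 \<le> \<theta>1 \<and> 0 \<le> \<theta>2 \<and> \<bar>\<theta>1 - \<theta>2\<bar> \<le> 1 \<and> T \<le> t \<longrightarrow>
      norm (volterra_semiflow_const \<alpha> g x t x0 \<theta>1 - volterra_semiflow_const \<alpha> g x t x0 \<theta>2)
        \<le> 2 * G_star g a b / (\<alpha> * Gamma \<alpha>) * \<bar>\<theta>1 - \<theta>2\<bar> powr \<alpha>)"
proof -
  note \<alpha> = assms(1,2)
  have g: "continuous_on A g" for A
    using local_lipschitz_continuous_on[OF assms(5), of 0] by (auto intro: continuous_on_subset)
  define G where "G = G_star g a b"
  have G: "0 < G" unfolding G_def using assms(3,4,6) by (intro G_star_pos g)
  have \<Gamma>: "0 < Gamma \<alpha>" "0 < Gamma (1 - \<alpha>)" using \<alpha> by (auto intro: Gamma_real_pos)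
  have "((\<lambda>T. R\<^sup>2 / (1 - \<alpha>) * T powr - \<alpha>) \<longlongrightarrow> R\<^sup>2 / (1 - \<alpha>) * 0) at_top"
    using \<alpha> by (intro tendsto_intros tendsto_neg_powr filterlim_ident) auto
  then have "\<forall>\<^sub>F T in at_top. R\<^sup>2 / (1 - \<alpha>) * T powr - \<alpha> < 2 * b * Gamma (1 - \<alpha>)"
    using assms(4) \<Gamma> by (intro order_tendstoD) auto
  then obtain L0 where "\<And>T. L0 \<le> T \<Longrightarrow> R\<^sup>2 / (1 - \<alpha>) * T powr - \<alpha> < 2 * b * Gamma (1 - \<alpha>)"
    by (auto simp: eventually_at_top_linorder)
  then obtain L where L: "0 < L" "\<And>T. L \<le> T \<Longrightarrow> R\<^sup>2 / (1 - \<alpha>) * T powr - \<alpha> \<le> 2 * b * Gamma (1 - \<alpha>)"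
    by (intro that[of "max 1 L0"]) (auto intro: less_imp_le)
  define \<rho> where "\<rho> = sqrt (a / b + 1 + R\<^sup>2)"
  have "bounded (g ` cball 0 \<rho>)"
    by (intro compact_imp_bounded compact_continuous_image g) auto
  then obtain M where M: "0 < M" "\<forall>x\<in>cball 0 \<rho>. norm (g x) \<le> M"
    unfolding bounded_pos by blast
  \<comment> \<open>For \<open>t \<ge> T\<close> the distance \<open>\<tau> = t - L\<close> to the initial phase satisfies \<open>\<tau> \<ge> 1\<close> and \<open>M L / \<tau> \<le> G / \<alpha>\<close>.\<close>
  define T where "T = L + 1 + \<alpha> * M * L / G"
  have aML: "0 \<le> \<alpha> * M * L / G" using \<alpha> M L G by simp
  have "0 < T" using L aML by (simp add: T_def)
  moreover have "norm (volterra_semiflow_const \<alpha> g x t x0 \<theta>1 - volterra_semiflow_const \<alpha> g x t x0 \<theta>2)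
        \<le> 2 * G / (\<alpha> * Gamma \<alpha>) * \<bar>\<theta>1 - \<theta>2\<bar> powr \<alpha>"
    if x0: "norm x0 \<le> R" and sol: "caputo_solution \<alpha> g x0 x"
      and \<theta>: "0 \<le> \<theta>1" "0 \<le> \<theta>2" "\<bar>\<theta>1 - \<theta>2\<bar> \<le> 1" and t: "T \<le> t" for x0 x \<theta>1 \<theta>2 t
  proof -
    have f: "continuous_on {p..q} (\<lambda>s. g (x s))" if "0 \<le> p" for p q
      using that by (intro continuous_on_compose2[OF g[of UNIV]]
          continuous_on_subset[OF caputo_solution_continuous[OF sol]]) auto
    have absorb: "(norm (x s))\<^sup>2 \<le> a / b + 1 + R\<^sup>2 * (1 - s / S)" if "0 \<le> s" "s \<le> S" "L \<le> S" for s S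
      using that L assms(3,4,6) x0 by (intro caputo_solution_absorption[OF \<alpha> sol g]) auto
    have fM: "norm (g (x s)) \<le> M" if "0 \<le> s" for s
    proof -
      \<comment> \<open>With the horizon \<open>max L s\<close> the barrier covers every time \<open>s\<close>, and it never exceeds its initial height.\<close>
      have "R\<^sup>2 * (1 - s / max L s) \<le> R\<^sup>2 * 1"
        using that L by (intro mult_left_mono) auto
      then have "(norm (x s))\<^sup>2 \<le> a / b + 1 + R\<^sup>2" using absorb[of s "max L s"] that by simp
      then have "norm (x s) \<le> \<rho>" unfolding \<rho>_def by (rule real_le_rsqrt)
      then show ?thesis using M by simp
    qed
    have fG: "norm (g (x s)) \<le> G" if "L \<le> s" for s
    proof -
      \<comment> \<open>The barrier with horizon \<open>s\<close> itself has come down to \<open>a/b + 1\<close> at time \<open>s\<close>.\<close>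
      have "(norm (x s))\<^sup>2 \<le> a / b + 1" using absorb[of s s] that L by simp
      then have "x s \<in> B_star a b"
        unfolding B_star_def delta_star_def by (simp add: real_le_rsqrt)
      then show ?thesis unfolding G_def by (intro G_star_upper g)
    qed
    have ordered: "norm (volterra_semiflow_const \<alpha> g x t x0 \<theta> - volterra_semiflow_const \<alpha> g x t x0 (\<theta> + h))
        \<le> 2 * G / (\<alpha> * Gamma \<alpha>) * h powr \<alpha>" if \<theta>: "0 \<le> \<theta>" and h: "0 \<le> h" "h \<le> 1" for \<theta> h
    proof -
      let ?k = "\<lambda>c s. (c - s) powr (\<alpha> - 1)"
      let ?d = "\<lambda>s. (?k (t + \<theta>) s - ?k (t + \<theta> + h) s) *\<^sub>R g (x s)"
      define \<tau> where "\<tau> = t - L"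
      have \<tau>: "1 \<le> \<tau>" "\<alpha> * M * L / G \<le> \<tau>" using t aML by (auto simp: \<tau>_def T_def)
      have Lt: "0 < L" "L < t" using L \<tau> by (auto simp: \<tau>_def)
      have int: "(\<lambda>s. ?k c s *\<^sub>R g (x s)) integrable_on {0..t}" if "t \<le> c" for c
        using has_integral_powr_kernel[OF \<alpha>(1) _ that, of 0] Lt
        by (intro nonneg_kernel_integrable f) auto
      have "integral {0..t} ?d = integral {0..t} (\<lambda>s. ?k (t + \<theta>) s *\<^sub>R g (x s))
          - integral {0..t} (\<lambda>s. ?k (t + \<theta> + h) s *\<^sub>R g (x s))"
        unfolding scaleR_diff_left using \<theta> h by (intro integral_diff int) auto
      then have diff: "volterra_semiflow_const \<alpha> g x t x0 \<theta> - volterra_semiflow_const \<alpha> g x t x0 (\<theta> + h)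
          = (1 / Gamma \<alpha>) *\<^sub>R integral {0..t} ?d"
        unfolding volterra_semiflow_const_def by (simp add: scaleR_diff_right add.assoc)
      have dint: "?d integrable_on {0..t}"
        unfolding scaleR_diff_left using \<theta> h by (intro integrable_diff int) auto
      have split: "integral {0..t} ?d = integral {0..L} ?d + integral {L..t} ?d"
        using Lt dint by (intro Henstock_Kurzweil_Integration.integral_combine[symmetric]) auto
      have late: "norm (integral {L..t} ?d) \<le> G * (h powr \<alpha> / \<alpha>)"
        using Lt \<theta> h by (intro powr_kernel_difference_bound \<alpha> f fG) auto
      have "norm (integral {0..L} ?d) \<le> (h / \<tau> * M) * (L - 0)"
      proof (rule integral_bound)
        show "continuous_on {0..L} ?d"
          using Lt \<theta> h by (intro continuous_intros f) auto
        show "norm (?d s) \<le> h / \<tau> * M" if "s \<in> {0..L}" for s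
        proof -
          have "\<bar>(t + \<theta> - s) powr (\<alpha> - 1) - (t + \<theta> - s + h) powr (\<alpha> - 1)\<bar> \<le> h / \<tau>"
            using that \<theta> by (intro powr_difference_far \<alpha> \<tau> h) (auto simp: \<tau>_def)
          then have "\<bar>?k (t + \<theta>) s - ?k (t + \<theta> + h) s\<bar> \<le> h / \<tau>"
            by (simp add: algebra_simps)
          then show ?thesis
            unfolding norm_scaleR real_norm_def using that h \<tau> by (intro mult_mono fM) auto
        qed
      qed (use Lt in auto)
      also have "\<dots> = h * (M * L / \<tau>)" by simp
      also have "\<dots> \<le> h powr \<alpha> * (G / \<alpha>)"
      proof (rule mult_mono)
        show "h \<le> h powr \<alpha>" using powr_mono'[of \<alpha> 1 h] h \<alpha> by simp
        show "M * L / \<tau> \<le> G / \<alpha>" using \<tau> G \<alpha> by (simp add: field_simps)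
      qed (use M Lt \<tau> in auto)
      finally have early: "norm (integral {0..L} ?d) \<le> G * (h powr \<alpha> / \<alpha>)" by (simp add: mult.commute)
      have "norm (integral {0..t} ?d) \<le> G * (h powr \<alpha> / \<alpha>) + G * (h powr \<alpha> / \<alpha>)"
        unfolding split by (intro norm_triangle_le add_mono early late)
      then have "(1 / Gamma \<alpha>) * norm (integral {0..t} ?d) \<le> (1 / Gamma \<alpha>) * (G * (h powr \<alpha> / \<alpha>) + G * (h powr \<alpha> / \<alpha>))"
        using \<Gamma> by (intro mult_left_mono) auto
      then show ?thesis
        unfolding diff using \<Gamma> by (simp add: algebra_simps)
    qed
    show ?thesis
    proof (cases "\<theta>1 \<le> \<theta>2")
      case True
      then show ?thesis using ordered[of \<theta>1 "\<theta>2 - \<theta>1"] \<theta> by (simp add: abs_minus_commute)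
    next
      case False
      then show ?thesis using ordered[of \<theta>2 "\<theta>1 - \<theta>2"] \<theta> by (simp add: norm_minus_commute)
    qed
  qed
  ultimately show ?thesis unfolding G_def by blast
qed

end
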